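(* Let $n\ge 2$ and let $B_n$ be the $n$-strand (unframed) braid group. For every braid $h\in B_n$ with $h\ne 1$ there is a cabling $c=(c_1,\dots,c_n)$, with $c_1,\dots,c_n$ positive integers, such that the $SU(2)$-Jones representation is nontrivial on the cabled braid: $\rho_N(c(h))\ne \mathrm{id}$, where $N=c_1+\cdots+c_n$.
   Context: For a braid $h\in B_n$ and positive integers $c_1,\dots,c_n$, the cabled braid $c(h)\in B_N$, $N=c_1+\cdots+c_n$, is obtained from a braid diagram of $h$ by replacing the $i$-th strand by $c_i$ parallel copies (using the blackboard framing). The (generic) $SU(2)$-Jones representation $\rho_N$ of $B_N$ is the homomorphism from $B_N$ to the group of units of the Temperley–Lieb algebra $TL_N$ over $\mathbb{C}(A)$, $A$ an indeterminate, with loop value $d=-A^2-A^{-2}$ and standard generators $e_1,\dots,e_{N-1}$ ($e_i^2=d\,e_i$, $e_ie_{i\pm1}e_i=e_i$, $e_ie_j=e_je_i$ for $|i-j|\ge2$), given on the standard braid generators by $\rho_N(\sigma_i)=A\cdot 1+A^{-1}e_i$. Here $TL_N$ may be viewed as acting on itself by left multiplication, so $\rho_N(g)\neq\mathrm{id}$ means that the image of $g$ in $TL_N$ is not the unit element. *)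

theory Defs
  imports
    "HOL-Algebra.QuotRing"
    "HOL-Library.Poly_Mapping"
    "HOL-Computational_Algebra.Polynomial"
    "HOL-Computational_Algebra.Fraction_Field"
    "HOL-Combinatorics.Permutations"
begin

section \<open>Braid groups\<close>

text \<open>The letter \<open>(i, True)\<close> stands for the Artin generator \<open>\<sigma>\<^sub>i\<close>, and \<open>(i, False)\<close> for
  its inverse. Generators and strand positions are numbered from 1. A word is read as a braid
  diagram from its first letter on.\<close>

type_synonym braid_word = "(nat \<times> bool) list"

definition braid_words :: "nat \<Rightarrow> braid_word set" where
  "braid_words n = lists ({1..<n} \<times> UNIV)"

inductive braid_eq :: "nat \<Rightarrow> braid_word \<Rightarrow> braid_word \<Rightarrow> bool" for n where
  refl: "w \<in> braid_words n \<Longrightarrow> braid_eq n w w"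
| sym: "braid_eq n u v \<Longrightarrow> braid_eq n v u"
| trans: "braid_eq n u v \<Longrightarrow> braid_eq n v w \<Longrightarrow> braid_eq n u w"
| append: "braid_eq n u u' \<Longrightarrow> braid_eq n v v' \<Longrightarrow> braid_eq n (u @ v) (u' @ v')"
| cancel: "i \<in> {1..<n} \<Longrightarrow> braid_eq n [(i, b), (i, \<not> b)] []"
| far: "i \<in> {1..<n} \<Longrightarrow> j \<in> {1..<n} \<Longrightarrow> i + 2 \<le> j \<Longrightarrow>
    braid_eq n [(i, True), (j, True)] [(j, True), (i, True)]"
| braid: "i \<in> {1..<n} \<Longrightarrow> Suc i \<in> {1..<n} \<Longrightarrow>
    braid_eq n [(i, True), (Suc i, True), (i, True)] [(Suc i, True), (i, True), (Suc i, True)]"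

definition braid_class :: "nat \<Rightarrow> braid_word \<Rightarrow> braid_word set" where
  "braid_class n w = {v. braid_eq n w v}"

definition braid_group :: "nat \<Rightarrow> braid_word set monoid" where
  "braid_group n = \<lparr>carrier = braid_class n ` braid_words n,
     monoid.mult = (\<lambda>g h. \<Union>u\<in>g. \<Union>v\<in>h. braid_class n (u @ v)),
     one = braid_class n []\<rparr>"

section \<open>Cabling\<close>

text \<open>\<open>braid_row b s a\<close> moves the strand at position \<open>s + a + 1\<close> to the left across the \<open>a\<close> strands at
  positions \<open>s + 1, \<dots>, s + a\<close>; all its crossings have sign \<open>b\<close>. \<open>block b s p q\<close> is the crossing
  of \<open>p\<close> parallel strands, at positions \<open>s + 1, \<dots>, s + p\<close>, with the \<open>q\<close> parallel strands to the
  right of them.\<close>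

definition braid_row :: "bool \<Rightarrow> nat \<Rightarrow> nat \<Rightarrow> braid_word" where
  "braid_row b s a = map (\<lambda>k. (k, b)) (rev [Suc s..<Suc (s + a)])"

definition block :: "bool \<Rightarrow> nat \<Rightarrow> nat \<Rightarrow> nat \<Rightarrow> braid_word" where
  "block b s p q = concat (map (\<lambda>j. braid_row b (s + j) p) [0..<q])"

text \<open>\<open>c i\<close> is the number of copies of the strand that starts at position \<open>i\<close>. Since strands carry
  their multiplicities along, the multiplicities seen after a crossing at \<open>i\<close> are swapped.\<close>

fun cable_word :: "(nat \<Rightarrow> nat) \<Rightarrow> braid_word \<Rightarrow> braid_word" where
  "cable_word c [] = []"
| "cable_word c ((i, b) # w) =
     block b (\<Sum>j=1..<i. c j) (c i) (c (Suc i)) @ cable_word (c \<circ> transpose i (Suc i)) w"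

text \<open>The cabled braid, as an element of \<open>braid_group (\<Sum>i=1..n. c i)\<close>. It does not depend on the
  diagram: see \<open>cable_braid_class\<close> below.\<close>

definition cable :: "nat \<Rightarrow> (nat \<Rightarrow> nat) \<Rightarrow> braid_word set \<Rightarrow> braid_word set" where
  "cable n c h = the_elem ((\<lambda>w. braid_class (\<Sum>i=1..n. c i) (cable_word c w)) ` h)"

section \<open>Temperley-Lieb algebras\<close>

type_synonym ratfun = "complex poly fract"

definition A_var :: ratfun where
  "A_var = Fract [:0, 1:] 1"

definition loop_value :: ratfun where
  "loop_value = - (A_var ^ 2) - inverse A_var ^ 2"

text \<open>Finitely supported functions on the free monoid \<open>tl_word\<close> form, under convolution, the free
  associative unital algebra over \<open>ratfun\<close> on generators indexed by \<open>nat\<close>.\<close>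

datatype tl_word = Word (letters: "nat list")

instantiation tl_word :: monoid_add
begin
definition zero_tl_word :: tl_word where
  "0 = Word []"
definition plus_tl_word :: "tl_word \<Rightarrow> tl_word \<Rightarrow> tl_word" where
  "u + v = Word (letters u @ letters v)"
instance
  by standard (simp_all add: zero_tl_word_def plus_tl_word_def)
end

type_synonym tl_poly = "tl_word \<Rightarrow>\<^sub>0 ratfun"

definition scal :: "ratfun \<Rightarrow> tl_poly" where
  "scal a = Poly_Mapping.single 0 a"

definition gen :: "nat \<Rightarrow> tl_poly" where
  "gen i = Poly_Mapping.single (Word [i]) 1"

text \<open>The free algebra on \<open>e\<^sub>1, \<dots>, e\<^sub>N\<^sub>-\<^sub>1\<close>.\<close>

definition free_alg :: "nat \<Rightarrow> tl_poly ring" where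
  "free_alg N = \<lparr>carrier = {p. \<forall>w\<in>Poly_Mapping.keys p. set (letters w) \<subseteq> {1..<N}},
     monoid.mult = (*), one = 1, zero = 0, add = (+)\<rparr>"

definition tl_relators :: "nat \<Rightarrow> tl_poly set" where
  "tl_relators N =
     {gen i * gen i - scal loop_value * gen i | i. i \<in> {1..<N}} \<union>
     {gen i * gen j * gen i - gen i | i j.
        i \<in> {1..<N} \<and> j \<in> {1..<N} \<and> (j = Suc i \<or> i = Suc j)} \<union>
     {gen i * gen j - gen j * gen i | i j.
        i \<in> {1..<N} \<and> j \<in> {1..<N} \<and> (i + 2 \<le> j \<or> j + 2 \<le> i)}"

text \<open>As \<open>free_alg N\<close> contains the scalars, the ideal generated in the ring-theoretic sense is also
  a linear subspace.\<close>

definition tl_ideal :: "nat \<Rightarrow> tl_poly set" where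
  "tl_ideal N = Idl\<^bsub>free_alg N\<^esub> (tl_relators N)"

definition TL :: "nat \<Rightarrow> tl_poly set ring" where
  "TL N = free_alg N Quot tl_ideal N"

definition tl_class :: "nat \<Rightarrow> tl_poly \<Rightarrow> tl_poly set" where
  "tl_class N p = tl_ideal N +>\<^bsub>free_alg N\<^esub> p"

section \<open>The generic Jones representation\<close>

fun jones_letter :: "nat \<times> bool \<Rightarrow> tl_poly" where
  "jones_letter (i, True) = scal A_var + scal (inverse A_var) * gen i"
| "jones_letter (i, False) = scal (inverse A_var) + scal A_var * gen i"

definition jones_word :: "nat \<Rightarrow> braid_word \<Rightarrow> tl_poly set" where
  "jones_word N w = foldr (\<lambda>l x. tl_class N (jones_letter l) \<otimes>\<^bsub>TL N\<^esub> x) w \<one>\<^bsub>TL N\<^esub>"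

text \<open>\<open>jones N\<close> is a homomorphism from \<open>braid_group N\<close> to the group of units of \<open>TL N\<close>: see
  \<open>jones_hom\<close> below.\<close>

definition jones :: "nat \<Rightarrow> braid_word set \<Rightarrow> tl_poly set" where
  "jones N g = the_elem (jones_word N ` g)"

section \<open>Well-definedness\<close>

subsection \<open>The braid group is a group\<close>

lemma braid_words_simps [simp]:
  "[] \<in> braid_words n"
  "l # w \<in> braid_words n \<longleftrightarrow> fst l \<in> {1..<n} \<and> w \<in> braid_words n"
  "u @ v \<in> braid_words n \<longleftrightarrow> u \<in> braid_words n \<and> v \<in> braid_words n"
  by (cases l; auto simp: braid_words_def)+

lemma braid_eq_words: "braid_eq n u v \<Longrightarrow> u \<in> braid_words n \<and> v \<in> braid_words n"
  by (induction rule: braid_eq.induct) auto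

lemma braid_class_eq_iff:
  assumes "u \<in> braid_words n"
  shows "braid_class n u = braid_class n v \<longleftrightarrow> braid_eq n u v"
proof
  assume "braid_class n u = braid_class n v"
  moreover have "u \<in> braid_class n u" using assms by (simp add: braid_class_def braid_eq.refl)
  ultimately show "braid_eq n u v" by (auto simp: braid_class_def braid_eq.sym)
next
  assume "braid_eq n u v"
  then show "braid_class n u = braid_class n v"
    unfolding braid_class_def by (blast intro: braid_eq.sym braid_eq.trans)
qed

lemma braid_group_mult:
  assumes "u \<in> braid_words n" "v \<in> braid_words n"
  shows "braid_class n u \<otimes>\<^bsub>braid_group n\<^esub> braid_class n v = braid_class n (u @ v)"
proof -
  have eq: "braid_class n (u' @ v') = braid_class n (u @ v)"
    if "u' \<in> braid_class n u" "v' \<in> braid_class n v" for u' v'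
  proof -
    have "braid_eq n (u @ v) (u' @ v')"
      using that by (intro braid_eq.append) (auto simp: braid_class_def)
    then show ?thesis using assms by (simp add: braid_class_eq_iff[symmetric])
  qed
  have ne: "u \<in> braid_class n u" "v \<in> braid_class n v"
    using assms by (simp_all add: braid_class_def braid_eq.refl)
  have "braid_class n u \<otimes>\<^bsub>braid_group n\<^esub> braid_class n v =
      (\<Union>u'\<in>braid_class n u. \<Union>v'\<in>braid_class n v. braid_class n (u' @ v'))"
    by (simp add: braid_group_def)
  also have "\<dots> = (\<Union>u'\<in>braid_class n u. \<Union>v'\<in>braid_class n v. braid_class n (u @ v))"
    by (intro SUP_cong HOL.refl eq)
  also have "\<dots> = braid_class n (u @ v)" using ne by blast
  finally show ?thesis .
qed

definition winv :: "braid_word \<Rightarrow> braid_word" where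
  "winv w = rev (map (\<lambda>(i, b). (i, \<not> b)) w)"

lemma winv_simps [simp]:
  "winv [] = []" "winv ((i, b) # w) = winv w @ [(i, \<not> b)]" "winv (u @ v) = winv v @ winv u"
  "winv (winv w) = w"
  by (auto simp: winv_def rev_map o_def case_prod_unfold)

lemma winv_words [simp]: "winv w \<in> braid_words n \<longleftrightarrow> w \<in> braid_words n"
  by (induction w) auto

lemma winv_right: "w \<in> braid_words n \<Longrightarrow> braid_eq n (w @ winv w) []"
proof (induction w)
  case Nil
  show ?case by (auto intro: braid_eq.refl)
next
  case (Cons l w)
  obtain i b where l: "l = (i, b)" by (cases l)
  have IH: "braid_eq n (w @ winv w) []" using Cons by simp
  have "braid_eq n ([(i, b)] @ (w @ winv w) @ [(i, \<not> b)]) ([(i, b)] @ [] @ [(i, \<not> b)])"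
    using Cons.prems l
    by (intro braid_eq.append[OF braid_eq.refl braid_eq.append[OF IH braid_eq.refl]]) auto
  then have 1: "braid_eq n ((l # w) @ winv (l # w)) [(i, b), (i, \<not> b)]"
    by (simp add: l)
  have 2: "braid_eq n [(i, b), (i, \<not> b)] []"
    using Cons.prems l by (intro braid_eq.cancel) auto
  show ?case by (rule braid_eq.trans[OF 1 2])
qed

lemma winv_left: "w \<in> braid_words n \<Longrightarrow> braid_eq n (winv w @ w) []"
  using winv_right[of "winv w" n] by simp

lemma group_braid_group: "group (braid_group n)"
proof (rule groupI)
  fix x y assume "x \<in> carrier (braid_group n)" "y \<in> carrier (braid_group n)"
  then obtain u v where uv: "u \<in> braid_words n" "v \<in> braid_words n"
    "x = braid_class n u" "y = braid_class n v"
    by (auto simp: braid_group_def)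
  show "x \<otimes>\<^bsub>braid_group n\<^esub> y \<in> carrier (braid_group n)"
    unfolding uv(3,4) braid_group_mult[OF uv(1,2)] using uv(1,2) by (auto simp: braid_group_def)
next
  fix x y z
  assume "x \<in> carrier (braid_group n)" "y \<in> carrier (braid_group n)" "z \<in> carrier (braid_group n)"
  then obtain u v w where uv: "u \<in> braid_words n" "v \<in> braid_words n" "w \<in> braid_words n"
    "x = braid_class n u" "y = braid_class n v" "z = braid_class n w"
    by (auto simp: braid_group_def)
  then show "x \<otimes>\<^bsub>braid_group n\<^esub> y \<otimes>\<^bsub>braid_group n\<^esub> z =
      x \<otimes>\<^bsub>braid_group n\<^esub> (y \<otimes>\<^bsub>braid_group n\<^esub> z)"
    by (simp add: braid_group_mult)
next
  show "\<one>\<^bsub>braid_group n\<^esub> \<in> carrier (braid_group n)"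
    by (auto simp: braid_group_def)
next
  fix x assume "x \<in> carrier (braid_group n)"
  then obtain u where u: "u \<in> braid_words n" "x = braid_class n u"
    by (auto simp: braid_group_def)
  have one: "\<one>\<^bsub>braid_group n\<^esub> = braid_class n []" by (simp add: braid_group_def)
  show "\<one>\<^bsub>braid_group n\<^esub> \<otimes>\<^bsub>braid_group n\<^esub> x = x"
    using u by (simp add: one braid_group_mult)
  have "braid_class n (winv u) \<otimes>\<^bsub>braid_group n\<^esub> x = \<one>\<^bsub>braid_group n\<^esub>"
    using u by (simp add: one braid_group_mult braid_class_eq_iff winv_left)
  moreover have "braid_class n (winv u) \<in> carrier (braid_group n)"
    using u by (auto simp: braid_group_def)
  ultimately show "\<exists>y\<in>carrier (braid_group n). y \<otimes>\<^bsub>braid_group n\<^esub> x = \<one>\<^bsub>braid_group n\<^esub>"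
    by blast
qed

subsection \<open>Cabling respects the braid relations\<close>

lemma winv_cong:
  assumes "braid_eq n u v"
  shows "braid_eq n (winv u) (winv v)"
proof -
  have w: "u \<in> braid_words n" "v \<in> braid_words n" using braid_eq_words[OF assms] by auto
  have 1: "braid_eq n (winv u @ (v @ winv v)) (winv u @ [])"
    using w by (intro braid_eq.append winv_right braid_eq.refl) auto
  have 2: "braid_eq n (winv u @ (u @ winv v)) (winv u @ (v @ winv v))"
    using w by (intro braid_eq.append[OF braid_eq.refl braid_eq.append[OF assms braid_eq.refl]]) auto
  have 3: "braid_eq n ((winv u @ u) @ winv v) ([] @ winv v)"
    using w by (intro braid_eq.append[OF winv_left braid_eq.refl]) auto
  show ?thesis
    using braid_eq.trans[OF braid_eq.sym[OF 1[simplified]]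
        braid_eq.trans[OF braid_eq.sym[OF 2] 3[simplified]]] .
qed

lemma commute_winv:
  assumes "braid_eq n (u @ v) (v @ u)"
  shows "braid_eq n (u @ winv v) (winv v @ u)"
proof -
  have w: "u \<in> braid_words n" "v \<in> braid_words n" using braid_eq_words[OF assms] by auto
  have 1: "braid_eq n ((winv v @ v) @ u @ winv v) ([] @ u @ winv v)"
    using w by (intro braid_eq.append[OF winv_left braid_eq.refl]) auto
  have 2: "braid_eq n (winv v @ (u @ v) @ winv v) (winv v @ (v @ u) @ winv v)"
    using w by (intro braid_eq.append[OF braid_eq.refl braid_eq.append[OF assms braid_eq.refl]]) auto
  have 3: "braid_eq n ((winv v @ u) @ (v @ winv v)) ((winv v @ u) @ [])"
    using w by (intro braid_eq.append[OF braid_eq.refl winv_right]) auto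
  show ?thesis
    using braid_eq.trans[OF braid_eq.sym[OF 1[simplified]]
        braid_eq.trans[OF braid_eq.sym[OF 2[simplified]] 3[simplified]]] by simp
qed

lemma far_letters:
  assumes "i \<in> {1..<n}" "j \<in> {1..<n}" "i + 2 \<le> j \<or> j + 2 \<le> i"
  shows "braid_eq n [(i, a), (j, b)] [(j, b), (i, a)]"
proof -
  have 1: "braid_eq n [(i, True), (j, True)] [(j, True), (i, True)]"
    using assms braid_eq.far[of i n j] braid_eq.sym[OF braid_eq.far[of j n i]] by blast
  have 2: "braid_eq n [(i, True), (j, b)] [(j, b), (i, True)]"
    using 1 commute_winv[of n "[(i, True)]" "[(j, True)]"] by (cases b) auto
  show ?thesis
    using 2 commute_winv[of n "[(j, b)]" "[(i, True)]"] by (cases a) (auto intro: braid_eq.sym)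
qed

lemma braid_letters:
  assumes "i \<in> {1..<n}" "Suc i \<in> {1..<n}"
  shows "braid_eq n [(i, b), (Suc i, b), (i, b)] [(Suc i, b), (i, b), (Suc i, b)]"
  using braid_eq.braid[OF assms] winv_cong[OF braid_eq.braid[OF assms]] by (cases b) auto

lemma braid_eq_ctx:
  assumes "braid_eq n l r" "u @ l @ v \<in> braid_words n"
  shows "braid_eq n (u @ l @ v) (u @ r @ v)"
  using assms(2) by (intro braid_eq.append[OF braid_eq.refl braid_eq.append[OF assms(1) braid_eq.refl]]) auto

lemma braid_eq_move:
  assumes "braid_eq n (u @ x) (y @ u)" "braid_eq n (v @ z) (x @ v)"
  shows "braid_eq n ((u @ v) @ z) (y @ (u @ v))"
proof -
  have w: "u \<in> braid_words n" "v \<in> braid_words n"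
    using braid_eq_words[OF assms(1)] braid_eq_words[OF assms(2)] by auto
  have 1: "braid_eq n (u @ (v @ z)) (u @ (x @ v))"
    by (rule braid_eq.append[OF braid_eq.refl[OF w(1)] assms(2)])
  have 2: "braid_eq n ((u @ x) @ v) ((y @ u) @ v)"
    by (rule braid_eq.append[OF assms(1) braid_eq.refl[OF w(2)]])
  show ?thesis
    using braid_eq.trans[OF 1 2[unfolded append_assoc]] by (simp only: append_assoc)
qed

lemma far_words:
  assumes "u \<in> braid_words n" "v \<in> braid_words n"
    and "\<And>x y. x \<in> set u \<Longrightarrow> y \<in> set v \<Longrightarrow> fst x + 2 \<le> fst y \<or> fst y + 2 \<le> fst x"
  shows "braid_eq n (u @ v) (v @ u)"
  using assms
proof (induction u)
  case Nil
  then show ?case by (auto intro: braid_eq.refl)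
next
  case (Cons x u)
  have "braid_eq n ([x] @ v) (v @ [x])"
    using Cons.prems
  proof (induction v)
    case Nil
    then show ?case by (auto intro: braid_eq.refl)
  next
    case (Cons y v)
    have "braid_eq n ([x] @ [y]) ([y] @ [x])"
      using Cons.prems(1,2) Cons.prems(3)[of x y] far_letters[of "fst x" n "fst y" "snd x" "snd y"]
      by simp
    moreover have "braid_eq n ([x] @ v) (v @ [x])"
      using Cons.prems by (intro Cons.IH) auto
    ultimately have "braid_eq n (([y] @ v) @ [x]) ([x] @ ([y] @ v))"
      by (rule braid_eq_move[OF braid_eq.sym braid_eq.sym])
    from braid_eq.sym[OF this] show ?case by simp
  qed
  moreover have "braid_eq n (u @ v) (v @ u)"
    using Cons.prems by (intro Cons.IH) auto
  ultimately have "braid_eq n (([x] @ u) @ v) (v @ ([x] @ u))"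
    by (intro braid_eq_move)
  then show ?case by simp
qed

lemma row_0 [simp]: "braid_row b s 0 = []"
  by (simp add: braid_row_def)

lemma row_Suc: "braid_row b s (Suc a) = (s + Suc a, b) # braid_row b s a"
  by (simp add: braid_row_def)

lemma row_Suc': "braid_row b s (Suc a) = braid_row b (Suc s) a @ [(Suc s, b)]"
  by (induction a) (simp_all add: row_Suc)

lemma row_append: "braid_row b s (a + a') = braid_row b (s + a) a' @ braid_row b s a"
  by (induction a') (simp_all add: row_Suc)

lemma row_words [simp]: "braid_row b s a \<in> braid_words n \<longleftrightarrow> a = 0 \<or> s + a < n"
  by (induction a) (auto simp: row_Suc)

lemma set_row: "set (braid_row b s a) = (\<lambda>k. (k, b)) ` {s<..s+a}"
  by (auto simp: braid_row_def)

lemma block_0 [simp]: "block b s p 0 = []" "block b s 0 q = []"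
  by (induction q) (simp_all add: block_def)

lemma block_Suc: "block b s p (Suc q) = block b s p q @ braid_row b (s + q) p"
  by (simp add: block_def)

lemma block_append: "block b s p (q + q') = block b s p q @ block b (s + q) p q'"
  by (induction q') (simp_all add: block_Suc add.assoc)

lemma set_block: "x \<in> set (block b s p q) \<Longrightarrow> s < fst x \<and> fst x < s + p + q"
  by (induction q) (auto simp: block_Suc set_row)

lemma block_words: "p = 0 \<or> q = 0 \<or> s + p + q \<le> n \<Longrightarrow> block b s p q \<in> braid_words n"
  by (induction q) (auto simp: block_Suc)

lemma row_row_slide:
  assumes "t + a + 2 \<le> n"
  shows "braid_eq n ((braid_row b t a @ braid_row b (Suc t) a) @ [(Suc t, b)])
                    ([(Suc t + a, b)] @ (braid_row b t a @ braid_row b (Suc t) a))"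
  using assms
proof (induction a arbitrary: t)
  case 0
  then show ?case by (auto intro!: braid_eq.refl)
next
  case (Suc a)
  let ?R = "braid_row b (Suc t) a" and ?S = "braid_row b (Suc (Suc t)) a"
  let ?x = "(Suc t, b)" and ?y = "(Suc (Suc t), b)"
  have xS: "braid_eq n ([?x] @ ?S) (?S @ [?x])"
    using Suc.prems by (intro far_words) (auto simp: set_row)
  have IH: "braid_eq n ((?R @ ?S) @ [?y]) ([(Suc (Suc t) + a, b)] @ (?R @ ?S))"
    using Suc.prems by (intro Suc.IH) auto
  have 1: "braid_eq n (braid_row b t (Suc a) @ braid_row b (Suc t) (Suc a)) ((?R @ ?S) @ [?x, ?y])"
    using braid_eq_ctx[OF xS, of ?R "[?y]"] Suc.prems by (simp add: row_Suc')
  have 2: "braid_eq n ([?x, ?y] @ [?x]) ([?y] @ [?x, ?y])"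
    using Suc.prems braid_letters[of "Suc t" n b] by auto
  have 3: "braid_eq n (((?R @ ?S) @ [?x, ?y]) @ [?x]) ([(Suc (Suc t) + a, b)] @ ((?R @ ?S) @ [?x, ?y]))"
    by (rule braid_eq_move[OF IH 2])
  have 4: "braid_eq n ((braid_row b t (Suc a) @ braid_row b (Suc t) (Suc a)) @ [?x]) (((?R @ ?S) @ [?x, ?y]) @ [?x])"
    using Suc.prems by (intro braid_eq.append[OF 1] braid_eq.refl) auto
  have 5: "braid_eq n ([(Suc (Suc t) + a, b)] @ (braid_row b t (Suc a) @ braid_row b (Suc t) (Suc a)))
      ([(Suc (Suc t) + a, b)] @ ((?R @ ?S) @ [?x, ?y]))"
    using Suc.prems by (intro braid_eq.append[OF _ 1] braid_eq.refl) auto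
  have "braid_eq n ((braid_row b t (Suc a) @ braid_row b (Suc t) (Suc a)) @ [?x])
      ([(Suc (Suc t) + a, b)] @ (braid_row b t (Suc a) @ braid_row b (Suc t) (Suc a)))"
    by (rule braid_eq.trans[OF 4 braid_eq.trans[OF 3 braid_eq.sym[OF 5]]])
  then show ?case by simp
qed

lemma block_slide_letter:
  assumes "s + a + m \<le> n" "s < k" "k < s + m"
  shows "braid_eq n (block b s a m @ [(k, b)]) ([(k + a, b)] @ block b s a m)"
proof -
  define j where "j = k - Suc s"
  define r where "r = m - j - 2"
  have m: "m = j + (2 + r)" and k: "k = Suc (s + j)" using assms by (auto simp: j_def r_def)
  have two: "block b (s + j) a 2 = braid_row b (s + j) a @ braid_row b (Suc (s + j)) a"
    by (simp add: numeral_2_eq_2 block_Suc)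
  have dec: "block b s a m = block b s a j @ (braid_row b (s + j) a @ braid_row b (Suc (s + j)) a) @
      block b (s + j + 2) a r"
    unfolding m block_append two ..
  have 1: "braid_eq n (block b s a j @ [(k + a, b)]) ([(k + a, b)] @ block b s a j)"
    using assms k m by (intro far_words block_words) (auto dest!: set_block)
  have 2: "braid_eq n ((braid_row b (s + j) a @ braid_row b (Suc (s + j)) a) @ [(k, b)])
      ([(k + a, b)] @ (braid_row b (s + j) a @ braid_row b (Suc (s + j)) a))"
    using row_row_slide[of "s + j" a n b] assms k m by simp
  have 3: "braid_eq n (block b (s + j + 2) a r @ [(k, b)]) ([(k, b)] @ block b (s + j + 2) a r)"
    using assms k m by (intro far_words block_words) (auto dest!: set_block)
  show ?thesis
    unfolding dec by (rule braid_eq_move[OF 1 braid_eq_move[OF 2 3]])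
qed

lemma block_slide_word:
  assumes "s + a + m \<le> n" "\<And>x. x \<in> set w \<Longrightarrow> s < fst x \<and> fst x < s + m \<and> snd x = b"
  shows "braid_eq n (block b s a m @ w) (map (\<lambda>(k, b). (k + a, b)) w @ block b s a m)"
  using assms(2)
proof (induction w)
  case Nil
  then show ?case using assms by (auto intro!: braid_eq.refl block_words)
next
  case (Cons x w)
  obtain k where x: "x = (k, b)" using Cons.prems[of x] by (cases x) auto
  have 1: "braid_eq n (block b s a m @ [(k, b)]) ([(k + a, b)] @ block b s a m)"
    using Cons.prems[of x] assms x by (intro block_slide_letter) auto
  have 2: "braid_eq n (block b s a m @ w) (map (\<lambda>(k, b). (k + a, b)) w @ block b s a m)"
    using Cons.prems by (intro Cons.IH) auto
  have w: "w \<in> braid_words n" using braid_eq_words[OF 2] by auto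
  have w': "k + a \<in> {1..<n}" using braid_eq_words[OF 1] by auto
  have 3: "braid_eq n ((block b s a m @ [(k, b)]) @ w) (([(k + a, b)] @ block b s a m) @ w)"
    by (rule braid_eq.append[OF 1 braid_eq.refl[OF w]])
  have 4: "braid_eq n ([(k + a, b)] @ (block b s a m @ w))
      ([(k + a, b)] @ (map (\<lambda>(k, b). (k + a, b)) w @ block b s a m))"
    using w' by (intro braid_eq.append[OF braid_eq.refl 2]) auto
  show ?case
    using braid_eq.trans[OF 3[unfolded append_assoc] 4] by (simp add: x)
qed

lemma shift_row: "map (\<lambda>(k, b). (k + a, b)) (braid_row b s p) = braid_row b (s + a) p"
  by (induction p) (simp_all add: row_Suc ac_simps)

lemma shift_block: "map (\<lambda>(k, b). (k + a, b)) (block b s p q) = block b (s + a) p q"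
  by (induction q) (simp_all add: block_Suc shift_row ac_simps)

lemma snd_block: "x \<in> set (block b s p q) \<Longrightarrow> snd x = b"
  by (induction q) (auto simp: block_Suc set_row)

lemma block_braid:
  assumes "s + a + b + c \<le> n"
  shows "braid_eq n (block e s a b @ block e (s + b) a c @ block e s b c)
                    (block e (s + a) b c @ block e s a c @ block e (s + c) a b)"
proof -
  have "braid_eq n (block e s a (b + c) @ block e s b c)
      (map (\<lambda>(k, b). (k + a, b)) (block e s b c) @ block e s a (b + c))"
    using assms by (intro block_slide_word) (auto dest: set_block snd_block)
  moreover have "block e s a (b + c) = block e s a c @ block e (s + c) a b"
    by (subst add.commute) (rule block_append)
  ultimately show ?thesis by (simp add: shift_block block_append)
qed

lemma block_split:
  assumes "s + a + a' + q \<le> n"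
  shows "braid_eq n (block b s (a + a') q) (block b (s + a) a' q @ block b s a q)"
  using assms
proof (induction q)
  case 0
  then show ?case by (auto intro: braid_eq.refl)
next
  case (Suc q)
  have IH: "braid_eq n (block b s (a + a') q) (block b (s + a) a' q @ block b s a q)"
    using Suc by auto
  have C: "braid_eq n (block b s a q @ braid_row b (s + q + a) a') (braid_row b (s + q + a) a' @ block b s a q)"
    using Suc.prems by (intro far_words block_words) (auto simp: set_row dest!: set_block)
  have 1: "braid_eq n (block b s (a + a') q @ (braid_row b (s + q + a) a' @ braid_row b (s + q) a))
      ((block b (s + a) a' q @ block b s a q) @ (braid_row b (s + q + a) a' @ braid_row b (s + q) a))"
    using Suc.prems by (intro braid_eq.append[OF IH] braid_eq.refl) auto
  have 2: "braid_eq n (block b (s + a) a' q @ (block b s a q @ braid_row b (s + q + a) a') @ braid_row b (s + q) a)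
      (block b (s + a) a' q @ (braid_row b (s + q + a) a' @ block b s a q) @ braid_row b (s + q) a)"
    using Suc.prems by (intro braid_eq_ctx[OF C]) (auto intro!: block_words)
  show ?case
    using braid_eq.trans[OF 1[unfolded append_assoc] 2[unfolded append_assoc]]
    by (simp add: block_Suc row_append ac_simps)
qed

lemma block_1_winv: "block (\<not> b) s 1 q = winv (braid_row b s q)"
  by (induction q) (simp_all add: block_Suc row_Suc)

lemma block_cancel:
  assumes "s + p + q \<le> n"
  shows "braid_eq n (block b s p q @ block (\<not> b) s q p) []"
proof -
  have "braid_eq n (block (\<not> b) s q p) (winv (block b s p q))"
    using assms
  proof (induction q)
    case 0
    then show ?case by (auto intro: braid_eq.refl)
  next
    case (Suc q)
    have 1: "braid_eq n (block (\<not> b) s (q + 1) p) (block (\<not> b) (s + q) 1 p @ block (\<not> b) s q p)"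
      using Suc.prems by (intro block_split) auto
    have 2: "braid_eq n (winv (braid_row b (s + q) p) @ block (\<not> b) s q p)
        (winv (braid_row b (s + q) p) @ winv (block b s p q))"
      using Suc by (intro braid_eq.append braid_eq.refl) auto
    show ?case
      using braid_eq.trans[OF 1[unfolded block_1_winv] 2] by (simp add: block_Suc)
  qed
  moreover have w: "block b s p q \<in> braid_words n" using assms by (intro block_words) auto
  ultimately have "braid_eq n (block b s p q @ block (\<not> b) s q p) (block b s p q @ winv (block b s p q))"
    by (intro braid_eq.append braid_eq.refl)
  with winv_right[OF w] show ?thesis by (rule braid_eq.trans[rotated])
qed

fun cable_after :: "(nat \<Rightarrow> nat) \<Rightarrow> braid_word \<Rightarrow> nat \<Rightarrow> nat" where
  "cable_after c [] = c"
| "cable_after c ((i, b) # w) = cable_after (c \<circ> transpose i (Suc i)) w"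

lemma cable_word_append: "cable_word c (u @ v) = cable_word c u @ cable_word (cable_after c u) v"
  by (induction c u rule: cable_word.induct) (simp_all del: o_apply)

lemma cable_after_append: "cable_after c (u @ v) = cable_after (cable_after c u) v"
  by (induction c u rule: cable_word.induct) (simp_all del: o_apply)

lemma sum_transpose:
  fixes c :: "nat \<Rightarrow> nat"
  assumes "i \<in> {1..<n}"
  shows "sum (c \<circ> transpose i (Suc i)) {1..n} = sum c {1..n}"
  using assms by (intro sum.permute[symmetric] permutes_swap_id) auto

lemma sum_cable_after: "u \<in> braid_words n \<Longrightarrow> sum (cable_after c u) {1..n} = sum c {1..n}"
  by (induction c u rule: cable_after.induct) (simp_all add: sum_transpose del: o_apply One_nat_def)

lemma offset_le:
  fixes c :: "nat \<Rightarrow> nat"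
  assumes "1 \<le> i" "Suc (Suc i) \<le> j" "j \<le> Suc n"
  shows "sum c {1..<i} + c i + c (Suc i) \<le> sum c {1..<j}" "sum c {1..<j} \<le> sum c {1..n}"
proof -
  have "sum c {1..<i} + c i + c (Suc i) = sum c {1..<Suc (Suc i)}" using assms by simp
  also have "\<dots> \<le> sum c {1..<j}" using assms by (intro sum_mono2) auto
  finally show "sum c {1..<i} + c i + c (Suc i) \<le> sum c {1..<j}" .
  show "sum c {1..<j} \<le> sum c {1..n}" using assms by (intro sum_mono2) auto
qed

lemma offset_le_total:
  fixes c :: "nat \<Rightarrow> nat"
  assumes "i \<in> {1..<n}"
  shows "sum c {1..<i} + c i + c (Suc i) \<le> sum c {1..n}"
  using offset_le(1)[of i "Suc n" n c] offset_le(2)[of i "Suc n" n c] assms by auto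

lemma cable_word_words:
  "w \<in> braid_words n \<Longrightarrow> cable_word c w \<in> braid_words (sum c {1..n})"
proof (induction c w rule: cable_word.induct)
  case (2 c i b w)
  have "cable_word (c \<circ> transpose i (Suc i)) w \<in> braid_words (sum (c \<circ> transpose i (Suc i)) {1..n})"
    using 2 by (simp del: o_apply One_nat_def)
  then have "cable_word (c \<circ> transpose i (Suc i)) w \<in> braid_words (sum c {1..n})"
    using 2 by (subst (asm) sum_transpose) auto
  moreover have "block b (sum c {1..<i}) (c i) (c (Suc i)) \<in> braid_words (sum c {1..n})"
    using 2 by (intro block_words disjI2 offset_le_total) auto
  ultimately show ?case by simp
qed simp

lemma sum_transpose_below:
  fixes c :: "nat \<Rightarrow> nat"
  assumes "j \<le> i"
  shows "sum (c \<circ> transpose i (Suc i)) {1..<j} = sum c {1..<j}"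
  using assms by (intro sum.cong) (auto simp: transpose_def)

lemma sum_transpose_above:
  fixes c :: "nat \<Rightarrow> nat"
  assumes "1 \<le> i" "Suc (Suc i) \<le> j"
  shows "sum (c \<circ> transpose i (Suc i)) {1..<j} = sum c {1..<j}"
  using assms by (intro sum.permute[symmetric] permutes_swap_id) auto

lemma sum_transpose_at:
  fixes c :: "nat \<Rightarrow> nat"
  assumes "1 \<le> i"
  shows "sum (c \<circ> transpose i (Suc i)) {1..<Suc i} = sum c {1..<i} + c (Suc i)"
proof -
  have "sum (c \<circ> transpose i (Suc i)) {1..<Suc i} =
      sum (c \<circ> transpose i (Suc i)) {1..<i} + c (Suc i)"
    using assms by simp
  then show ?thesis by (simp only: sum_transpose_below[OF order_refl])
qed

lemma cable_word_cong:
  "braid_eq n u v \<Longrightarrow>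
     cable_after c u = cable_after c v \<and> braid_eq (sum c {1..n}) (cable_word c u) (cable_word c v)"
proof (induction arbitrary: c rule: braid_eq.induct)
  case (refl w)
  then show ?case by (simp add: cable_word_words braid_eq.refl del: One_nat_def)
next
  case (sym u v)
  then show ?case by (metis braid_eq.sym)
next
  case (trans u v w)
  then show ?case by (metis braid_eq.trans)
next
  case (append u u' v v')
  have "u \<in> braid_words n" using braid_eq_words[OF append.hyps(1)] by simp
  then have "braid_eq (sum c {1..n}) (cable_word (cable_after c u) v) (cable_word (cable_after c u) v')"
    using append.IH(2)[of "cable_after c u"] by (simp add: sum_cable_after del: One_nat_def)
  then show ?case
    using append.IH(1)[of c] append.IH(2)[of "cable_after c u"]
    by (simp add: cable_word_append cable_after_append braid_eq.append del: One_nat_def)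
next
  case (cancel i b)
  have "braid_eq (sum c {1..n})
      (block b (sum c {1..<i}) (c i) (c (Suc i)) @ block (\<not> b) (sum c {1..<i}) (c (Suc i)) (c i)) []"
    using cancel by (intro block_cancel offset_le_total)
  moreover have "c \<circ> transpose i (Suc i) \<circ> transpose i (Suc i) = c"
    by (simp add: comp_assoc)
  ultimately show ?case
    by (simp add: sum_transpose_below del: o_apply) (simp add: o_def)
next
  case (far i j)
  let ?s = "sum c {1..<i}" and ?t = "sum c {1..<j}"
  let ?x = "transpose i (Suc i)" and ?y = "transpose j (Suc j)"
  have "c \<circ> ?x \<circ> ?y = c \<circ> ?y \<circ> ?x"
    using far by (auto simp: transpose_def)
  moreover have "cable_word c [(i, True), (j, True)] =
      block True ?s (c i) (c (Suc i)) @ block True ?t (c j) (c (Suc j))"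
    using far sum_transpose_above[of i j c]
    by (simp del: o_apply One_nat_def) (simp add: transpose_def)
  moreover have "cable_word c [(j, True), (i, True)] =
      block True ?t (c j) (c (Suc j)) @ block True ?s (c i) (c (Suc i))"
    using far sum_transpose_below[of i j c]
    by (simp del: o_apply One_nat_def) (simp add: transpose_def)
  moreover have "braid_eq (sum c {1..n})
      (block True ?s (c i) (c (Suc i)) @ block True ?t (c j) (c (Suc j)))
      (block True ?t (c j) (c (Suc j)) @ block True ?s (c i) (c (Suc i)))"
  proof (rule far_words)
    show "block True ?s (c i) (c (Suc i)) \<in> braid_words (sum c {1..n})"
      "block True ?t (c j) (c (Suc j)) \<in> braid_words (sum c {1..n})"
      using far by (intro block_words disjI2 offset_le_total; simp)+
    fix x y
    assume "x \<in> set (block True ?s (c i) (c (Suc i)))" "y \<in> set (block True ?t (c j) (c (Suc j)))"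
    then have "fst x < ?s + c i + c (Suc i)" "?t < fst y" by (auto dest: set_block)
    moreover have "?s + c i + c (Suc i) \<le> ?t" using far by (intro offset_le(1)[of i j n]) auto
    ultimately show "fst x + 2 \<le> fst y \<or> fst y + 2 \<le> fst x" by linarith
  qed
  ultimately show ?case by simp
next
  case (braid i)
  let ?s = "sum c {1..<i}"
  let ?x = "transpose i (Suc i)" and ?y = "transpose (Suc i) (Suc (Suc i))"
  have i: "1 \<le> i" using braid by simp
  have "c \<circ> ?x \<circ> ?y \<circ> ?x = c \<circ> ?y \<circ> ?x \<circ> ?y"
    by (auto simp: transpose_def fun_eq_iff)
  moreover have "cable_word c [(i, True), (Suc i, True), (i, True)] =
      block True ?s (c i) (c (Suc i)) @ block True (?s + c (Suc i)) (c i) (c (Suc (Suc i))) @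
      block True ?s (c (Suc i)) (c (Suc (Suc i)))"
  proof -
    have "sum (c \<circ> ?x \<circ> ?y) {1..<i} = ?s"
      by (simp only: sum_transpose_below[of i "Suc i" "c \<circ> ?x"] sum_transpose_below[of i i c])
    then show ?thesis
      by (simp only: cable_word.simps sum_transpose_at[OF i]) (simp add: transpose_def)
  qed
  moreover have "cable_word c [(Suc i, True), (i, True), (Suc i, True)] =
      block True (?s + c i) (c (Suc i)) (c (Suc (Suc i))) @ block True ?s (c i) (c (Suc (Suc i))) @
      block True (?s + c (Suc (Suc i))) (c i) (c (Suc i))"
  proof -
    have "sum (c \<circ> ?y) {1..<i} = ?s" by (simp only: sum_transpose_below[of i "Suc i" c])
    moreover have "sum (c \<circ> ?y \<circ> ?x) {1..<Suc i} = sum (c \<circ> ?y) {1..<i} + (c \<circ> ?y) (Suc i)"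
      by (rule sum_transpose_at[OF i])
    moreover have "sum c {1..<Suc i} = ?s + c i" using i by simp
    ultimately show ?thesis
      by (simp only: cable_word.simps) (simp add: transpose_def)
  qed
  moreover have "?s + c i + c (Suc i) + c (Suc (Suc i)) \<le> sum c {1..n}"
    using offset_le_total[of "Suc i" n c] braid by simp
  ultimately show ?case
    using block_braid[of ?s "c i" "c (Suc i)" "c (Suc (Suc i))" "sum c {1..n}" True] by simp
qed

lemma the_elem_image_class:
  assumes "w \<in> braid_words n" "\<And>v. braid_eq n w v \<Longrightarrow> f v = f w"
  shows "the_elem (f ` braid_class n w) = f w"
proof -
  have "f ` braid_class n w = {f w}"
    using assms by (auto simp: braid_class_def intro: braid_eq.refl)
  then show ?thesis by simp
qed

theorem cable_braid_class:
  assumes "w \<in> braid_words n"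
  shows "cable n c (braid_class n w) = braid_class (\<Sum>i=1..n. c i) (cable_word c w)"
    and "cable n c (braid_class n w) \<in> carrier (braid_group (\<Sum>i=1..n. c i))"
proof -
  show *: "cable n c (braid_class n w) = braid_class (\<Sum>i=1..n. c i) (cable_word c w)"
    unfolding cable_def
  proof (rule the_elem_image_class[OF assms])
    fix v assume "braid_eq n w v"
    then have "braid_eq (sum c {1..n}) (cable_word c w) (cable_word c v)"
      using cable_word_cong by blast
    then show "braid_class (\<Sum>i=1..n. c i) (cable_word c v) = braid_class (\<Sum>i=1..n. c i) (cable_word c w)"
      using braid_class_eq_iff[OF cable_word_words[OF assms]] by metis
  qed
  show "cable n c (braid_class n w) \<in> carrier (braid_group (\<Sum>i=1..n. c i))"
    unfolding * using cable_word_words[OF assms, of c] by (simp add: braid_group_def del: One_nat_def)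
qed

subsection \<open>The Jones representation is a homomorphism\<close>

lemma free_alg_simps [simp]:
  "x \<otimes>\<^bsub>free_alg N\<^esub> y = x * y" "x \<oplus>\<^bsub>free_alg N\<^esub> y = x + y"
  "\<one>\<^bsub>free_alg N\<^esub> = 1" "\<zero>\<^bsub>free_alg N\<^esub> = 0"
  by (simp_all add: free_alg_def)

lemma carrier_free_alg:
  "p \<in> carrier (free_alg N) \<longleftrightarrow> (\<forall>w\<in>Poly_Mapping.keys p. set (letters w) \<subseteq> {1..<N})"
  by (simp add: free_alg_def)

lemma free_alg_closed:
  assumes "p \<in> carrier (free_alg N)" "q \<in> carrier (free_alg N)"
  shows "p + q \<in> carrier (free_alg N)" "p - q \<in> carrier (free_alg N)"
    "p * q \<in> carrier (free_alg N)" "- p \<in> carrier (free_alg N)"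
proof -
  show "p + q \<in> carrier (free_alg N)"
    using assms Poly_Mapping.keys_add[of p q] unfolding carrier_free_alg by blast
  show "p - q \<in> carrier (free_alg N)"
    using assms keys_diff[of p q] unfolding carrier_free_alg by blast
  show "- p \<in> carrier (free_alg N)"
    using assms unfolding carrier_free_alg by simp
  show "p * q \<in> carrier (free_alg N)"
    unfolding carrier_free_alg
  proof
    fix w assume "w \<in> Poly_Mapping.keys (p * q)"
    then obtain u v where "u \<in> Poly_Mapping.keys p" "v \<in> Poly_Mapping.keys q" "w = u + v"
      using keys_mult[of p q] by blast
    then show "set (letters w) \<subseteq> {1..<N}"
      using assms unfolding carrier_free_alg by (fastforce simp: plus_tl_word_def)
  qed
qed

lemma free_alg_base:
  "0 \<in> carrier (free_alg N)" "1 \<in> carrier (free_alg N)" "scal a \<in> carrier (free_alg N)"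
  "i \<in> {1..<N} \<Longrightarrow> gen i \<in> carrier (free_alg N)"
  by (auto simp: carrier_free_alg scal_def gen_def zero_tl_word_def)

lemma ring_free_alg: "ring (free_alg N)"
proof (rule ringI)
  show "abelian_group (free_alg N)"
  proof (rule abelian_groupI)
    fix x assume "x \<in> carrier (free_alg N)"
    then show "\<exists>y\<in>carrier (free_alg N). y \<oplus>\<^bsub>free_alg N\<^esub> x = \<zero>\<^bsub>free_alg N\<^esub>"
      using free_alg_closed(4) by (intro bexI[of _ "- x"]) auto
  qed (auto simp: free_alg_closed free_alg_base add.assoc add.commute)
  show "monoid (free_alg N)"
    by (rule monoidI) (auto simp: free_alg_closed free_alg_base mult.assoc)
qed (auto simp: distrib_left distrib_right)

lemma tl_relators_carrier: "tl_relators N \<subseteq> carrier (free_alg N)"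
  unfolding tl_relators_def by (auto intro!: free_alg_closed free_alg_base)

lemma ideal_tl_ideal: "ideal (tl_ideal N) (free_alg N)"
  unfolding tl_ideal_def by (intro ring.genideal_ideal[OF ring_free_alg] tl_relators_carrier)

lemma tl_relators_ideal: "x \<in> tl_relators N \<Longrightarrow> x \<in> tl_ideal N"
  unfolding tl_ideal_def using ring.genideal_self[OF ring_free_alg tl_relators_carrier] by blast

lemma tl_relations:
  "i \<in> {1..<N} \<Longrightarrow> gen i * gen i - scal loop_value * gen i \<in> tl_ideal N"
  "i \<in> {1..<N} \<Longrightarrow> j \<in> {1..<N} \<Longrightarrow> j = Suc i \<or> i = Suc j \<Longrightarrow>
    gen i * gen j * gen i - gen i \<in> tl_ideal N"
  "i \<in> {1..<N} \<Longrightarrow> j \<in> {1..<N} \<Longrightarrow> i + 2 \<le> j \<or> j + 2 \<le> i \<Longrightarrow>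
    gen i * gen j - gen j * gen i \<in> tl_ideal N"
  by (rule tl_relators_ideal, unfold tl_relators_def, blast)+

lemma ring_TL: "ring (TL N)"
  unfolding TL_def by (rule ideal.quotient_is_ring[OF ideal_tl_ideal])

lemma tl_class_hom: "tl_class N \<in> ring_hom (free_alg N) (TL N)"
proof -
  have "tl_class N = (+>\<^bsub>free_alg N\<^esub>) (tl_ideal N)" by (auto simp: tl_class_def)
  then show ?thesis
    unfolding TL_def using ideal.rcos_ring_hom[OF ideal_tl_ideal] by simp
qed

lemma tl_class_cong:
  assumes "x \<in> carrier (free_alg N)" "y \<in> carrier (free_alg N)" "x - y \<in> tl_ideal N"
  shows "tl_class N x = tl_class N y"
proof -
  interpret ideal "tl_ideal N" "free_alg N" by (rule ideal_tl_ideal)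
  have "x \<in> tl_class N y"
    unfolding tl_class_def a_r_coset_def' using assms(3) by (auto intro!: bexI[of _ "x - y"])
  then show ?thesis
    unfolding tl_class_def using a_repr_independence[OF _ assms(2) a_subgroup] by simp
qed

lemma tl_ideal_closed:
  "x \<in> tl_ideal N \<Longrightarrow> y \<in> tl_ideal N \<Longrightarrow> x + y \<in> tl_ideal N"
  "x \<in> tl_ideal N \<Longrightarrow> scal a * x \<in> tl_ideal N"
  using additive_subgroup.a_closed[OF ideal.axioms(1)[OF ideal_tl_ideal], of x N y]
    ideal.I_l_closed[OF ideal_tl_ideal, of x N "scal a"] free_alg_base(3)[of a N]
  by simp_all

lemma scal_simps:
  "scal (a + b) = scal a + scal b" "scal (a * b) = scal a * scal b" "scal 1 = 1"
  "scal (- a) = - scal a" "scal (a - b) = scal a - scal b"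
  by (simp_all add: scal_def single_add mult_single single_uminus single_diff)

lemma scal_loop_value:
  "scal loop_value = - (scal A_var * scal A_var) - scal (inverse A_var) * scal (inverse A_var)"
  by (simp only: loop_value_def power2_eq_square scal_simps)

lemma scal_central: "gen i * scal a = scal a * gen i"
  by (simp add: scal_def gen_def mult_single)

lemma A_var_nonzero: "A_var \<noteq> 0"
  by (simp add: A_var_def Zero_fract_def eq_fract)

lemma jones_letter_carrier:
  "fst l \<in> {1..<N} \<Longrightarrow> jones_letter l \<in> carrier (free_alg N)"
  by (cases l rule: jones_letter.cases) (auto intro!: free_alg_closed free_alg_base)

lemma jones_cancel:
  assumes "i \<in> {1..<N}"
  shows "jones_letter (i, b) * jones_letter (i, \<not> b) - 1 \<in> tl_ideal N"
proof -
  let ?a = "scal A_var" and ?b = "scal (inverse A_var)" and ?e = "gen i"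
  have ab: "?a * ?b = 1" "?b * ?a = 1"
    using A_var_nonzero by (simp_all add: scal_simps(2)[symmetric] scal_simps(3))
  have ab': "?a * (?b * z) = z" "?b * (?a * z) = z" for z
    by (simp_all add: mult.assoc[symmetric] ab)
  have c: "?e * ?a = ?a * ?e" "?e * (?a * z) = ?a * (?e * z)" "?e * ?b = ?b * ?e" "?e * (?b * z) = ?b * (?e * z)" for z
    by (simp_all add: scal_central mult.assoc[symmetric])
  have "jones_letter (i, b) * jones_letter (i, \<not> b) - 1 = ?e * ?e - scal loop_value * ?e"
    by (cases b) (simp_all add: algebra_simps ab ab' c scal_loop_value)
  also have "\<dots> \<in> tl_ideal N"
    using assms by (rule tl_relations(1))
  finally show ?thesis .
qed

lemma jones_far:
  assumes "i \<in> {1..<N}" "j \<in> {1..<N}" "i + 2 \<le> j"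
  shows "jones_letter (i, True) * jones_letter (j, True)
      - jones_letter (j, True) * jones_letter (i, True) \<in> tl_ideal N"
proof -
  let ?a = "scal A_var" and ?b = "scal (inverse A_var)" and ?e = "gen i" and ?f = "gen j"
  have c: "?e * ?a = ?a * ?e" "?e * (?a * z) = ?a * (?e * z)" "?e * ?b = ?b * ?e"
    "?e * (?b * z) = ?b * (?e * z)" "?f * ?a = ?a * ?f" "?f * (?a * z) = ?a * (?f * z)"
    "?f * ?b = ?b * ?f" "?f * (?b * z) = ?b * (?f * z)" for z
    by (simp_all add: scal_central mult.assoc[symmetric])
  have ba: "?b * ?a = ?a * ?b" "?b * (?a * z) = ?a * (?b * z)" for z
    by (simp_all add: scal_simps(2)[symmetric] mult.assoc[symmetric] mult.commute)
  have "jones_letter (i, True) * jones_letter (j, True) - jones_letter (j, True) * jones_letter (i, True)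
      = scal (inverse A_var * inverse A_var) * (?e * ?f - ?f * ?e)"
    by (simp add: algebra_simps c ba scal_simps)
  also have "\<dots> \<in> tl_ideal N"
    using assms by (intro tl_ideal_closed tl_relations) auto
  finally show ?thesis .
qed

lemma braid_identity:
  fixes a b e f :: "'a::ring_1"
  assumes "a * b = 1" "b * a = 1" "e * a = a * e" "e * b = b * e" "f * a = a * f" "f * b = b * f"
  shows "(a + b * e) * (a + b * f) * (a + b * e) - (a + b * f) * (a + b * e) * (a + b * f) =
    b * (e * e - (- (a * a) - b * b) * e) + - b * (f * f - (- (a * a) - b * b) * f) +
    b * b * b * (e * f * e - e) + - (b * b * b) * (f * e * f - f)"
proof -
  have "a * (b * z) = z" "b * (a * z) = z" "e * (a * z) = a * (e * z)" "e * (b * z) = b * (e * z)"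
    "f * (a * z) = a * (f * z)" "f * (b * z) = b * (f * z)" for z
    by (simp_all add: assms mult.assoc[symmetric])
  then show ?thesis by (simp add: algebra_simps assms)
qed

lemma jones_braid:
  assumes "i \<in> {1..<N}" "Suc i \<in> {1..<N}"
  shows "jones_letter (i, True) * jones_letter (Suc i, True) * jones_letter (i, True)
      - jones_letter (Suc i, True) * jones_letter (i, True) * jones_letter (Suc i, True) \<in> tl_ideal N"
proof -
  let ?a = "scal A_var" and ?b = "scal (inverse A_var)" and ?e = "gen i" and ?f = "gen (Suc i)"
  have ab: "?a * ?b = 1" "?b * ?a = 1"
    using A_var_nonzero by (simp_all add: scal_simps(2)[symmetric] scal_simps(3))
  have "jones_letter (i, True) * jones_letter (Suc i, True) * jones_letter (i, True)
      - jones_letter (Suc i, True) * jones_letter (i, True) * jones_letter (Suc i, True) =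
      scal (inverse A_var) * (?e * ?e - scal loop_value * ?e)
      + scal (- inverse A_var) * (?f * ?f - scal loop_value * ?f)
      + scal (inverse A_var * inverse A_var * inverse A_var) * (?e * ?f * ?e - ?e)
      + scal (- (inverse A_var * inverse A_var * inverse A_var)) * (?f * ?e * ?f - ?f)"
    unfolding jones_letter.simps scal_loop_value scal_simps(2,4)
    by (rule braid_identity[OF ab scal_central scal_central scal_central scal_central])
  also have "\<dots> \<in> tl_ideal N"
    using assms by (intro tl_ideal_closed tl_relations) auto
  finally show ?thesis .
qed

lemma jones_word_carrier: "w \<in> braid_words N \<Longrightarrow> jones_word N w \<in> carrier (TL N)"
proof (induction w)
  case Nil
  show ?case by (simp add: jones_word_def ring.ring_simprules(6)[OF ring_TL])
next
  case (Cons l w)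
  then show ?case
    using ring_hom_closed[OF tl_class_hom jones_letter_carrier[of l N]]
    by (simp add: jones_word_def ring.ring_simprules(5)[OF ring_TL])
qed

lemma jones_word_append:
  "u \<in> braid_words N \<Longrightarrow> v \<in> braid_words N \<Longrightarrow>
     jones_word N (u @ v) = jones_word N u \<otimes>\<^bsub>TL N\<^esub> jones_word N v"
proof (induction u)
  case Nil
  then show ?case
    using jones_word_carrier[of v N] ring.is_monoid[OF ring_TL]
    by (simp add: jones_word_def monoid.l_one)
next
  case (Cons l u)
  then show ?case
    using ring_hom_closed[OF tl_class_hom jones_letter_carrier[of l N]]
      jones_word_carrier[of u N] jones_word_carrier[of v N] ring.is_monoid[OF ring_TL, of N]
    by (simp add: jones_word_def monoid.m_assoc)
qed

text \<open>In \<open>TL N\<close>, \<open>jones_word\<close> is the class of the product taken in the free algebra.\<close>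

lemma jones_word_tl_class:
  "w \<in> braid_words N \<Longrightarrow> prod_list (map jones_letter w) \<in> carrier (free_alg N) \<and>
     jones_word N w = tl_class N (prod_list (map jones_letter w))"
proof (induction w)
  case Nil
  show ?case using ring_hom_one[OF tl_class_hom] by (simp add: jones_word_def free_alg_base)
next
  case (Cons l w)
  then show ?case
    using ring_hom_mult[OF tl_class_hom jones_letter_carrier[of l N], of "prod_list (map jones_letter w)"]
      jones_letter_carrier[of l N]
    by (simp add: jones_word_def free_alg_closed)
qed

lemma jones_word_eqI:
  assumes "u \<in> braid_words N" "v \<in> braid_words N"
    and "prod_list (map jones_letter u) - prod_list (map jones_letter v) \<in> tl_ideal N"
  shows "jones_word N u = jones_word N v"
  using jones_word_tl_class[OF assms(1)] jones_word_tl_class[OF assms(2)]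
    tl_class_cong[OF _ _ assms(3)] by simp

lemma jones_word_cong: "braid_eq N u v \<Longrightarrow> jones_word N u = jones_word N v"
proof (induction rule: braid_eq.induct)
  case (append u u' v v')
  then show ?case using braid_eq_words by (simp add: jones_word_append)
next
  case (cancel i b)
  then show ?case using jones_cancel[of i N b] by (intro jones_word_eqI) auto
next
  case (far i j)
  then show ?case using jones_far[of i N j] by (intro jones_word_eqI) auto
next
  case (braid i)
  then show ?case
    using jones_braid[of i N] by (intro jones_word_eqI) (auto simp: mult.assoc)
qed simp_all

theorem jones_braid_class:
  "w \<in> braid_words N \<Longrightarrow> jones N (braid_class N w) = jones_word N w"
  unfolding jones_def by (rule the_elem_image_class) (simp_all add: jones_word_cong)

theorem jones_generator:
  assumes "i \<in> {1..<N}"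
  shows "jones N (braid_class N [(i, True)]) =
    tl_class N (scal A_var + scal (inverse A_var) * gen i)"
  using assms jones_word_tl_class[of "[(i, True)]" N] by (simp add: jones_braid_class)

theorem jones_hom: "jones N \<in> hom (braid_group N) (units_of (TL N))"
proof -
  interpret ring "TL N" by (rule ring_TL)
  have unit: "jones_word N w \<in> Units (TL N)" if w: "w \<in> braid_words N" for w
  proof -
    have "jones_word N (w @ winv w) = jones_word N []" "jones_word N (winv w @ w) = jones_word N []"
      using jones_word_cong[OF winv_right[OF w]] jones_word_cong[OF winv_left[OF w]] by simp_all
    moreover have "jones_word N [] = \<one>\<^bsub>TL N\<^esub>" by (simp add: jones_word_def)
    ultimately show ?thesis
      using w jones_word_carrier[of w N] jones_word_carrier[of "winv w" N]
      unfolding Units_def by (auto simp: jones_word_append)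
  qed
  show ?thesis
  proof (rule homI)
    fix g assume "g \<in> carrier (braid_group N)"
    then show "jones N g \<in> carrier (units_of (TL N))"
      using unit by (auto simp: braid_group_def jones_braid_class units_of_carrier)
  next
    fix g h assume "g \<in> carrier (braid_group N)" "h \<in> carrier (braid_group N)"
    then obtain u v where "u \<in> braid_words N" "v \<in> braid_words N"
      "g = braid_class N u" "h = braid_class N v"
      by (auto simp: braid_group_def)
    then show "jones N (g \<otimes>\<^bsub>braid_group N\<^esub> h) = jones N g \<otimes>\<^bsub>units_of (TL N)\<^esub> jones N h"
      by (simp add: braid_group_mult jones_braid_class jones_word_append units_of_mult)
  qed
qed

end

theory Submission
  imports Defs
begin

text \<open>
  The Temperley-Lieb algebra acts on the weight space of \<open>(\<complex>\<^sup>2)\<^sup>\<otimes>\<^sup>N\<close> with two spins down, that is, on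
  functions of two positions \<open>p < q\<close>. Up to the scalar \<open>A\<close>, and in a suitable basis, the braid
  generators act as the elementary steps of an asymmetric exclusion process with two particles and
  parameter \<open>\<tau> = A\<^sup>-\<^sup>4\<close> (\<open>hop\<close>). If each strand is replaced by \<open>m\<close> parallel strands, the crossing of
  two cables preserves the functions that depend only on the cables containing the two particles
  (\<open>cross_cable_of\<close>), and its matrix is polynomial in \<open>Q = \<tau>\<^sup>m\<close> and \<open>t = A\<^sup>4\<close>. Two positive words whose
  cables have the same Jones image for every \<open>m \<ge> 2\<close> therefore act in the same way for independent
  \<open>Q\<close> and \<open>t\<close>, because a polynomial in \<open>Q\<close> with infinitely many roots is zero. In particular
  they act in the same way for \<open>t = 0\<close> and \<open>Q = 1/2\<close> (\<open>braid_vec_eq_specialised\<close>).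

  The resulting module contains the Lawrence-Krammer representation as the kernel of the map that
  removes a particle, and the proof ends with a version of Krammer's argument for its faithfulness.
  For \<open>t = 0\<close> and \<open>0 < Q < 1\<close> there are coordinates, one for each pair \<open>a < b\<close>, in which generators
  act with nonnegative entries, and which are all positive on a start vector
  (\<open>krammer_coord_step\<close>). After a positive word has acted, the coordinate \<open>(k, k + 1)\<close> is zero if and
  only if the word is right divisible by \<open>\<sigma>\<^sub>k\<close> (\<open>krammer_last_zero\<close>, \<open>krammer_zero_divisible\<close>).
  Positive words with equal coordinates thus have a common last letter; after it is cancelled,
  induction shows that the words represent the same braid (\<open>same_jones_imp_braid_eq\<close>).

  Finally, for any braid \<open>h\<close> some power \<open>z\<close> of the full twist makes \<open>z h\<close> positive, and \<open>z\<close> is itself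
  positive. If all cablings of \<open>h\<close> had trivial Jones image, then the cablings of \<open>z h\<close> and of \<open>z\<close> would
  have the same images, so \<open>z h = z\<close> and \<open>h\<close> would be trivial.
\<close>

section \<open>Positive braids and the full twist\<close>

definition positive :: "nat list \<Rightarrow> braid_word" where
  "positive ks = map (\<lambda>k. (k, True)) ks"

lemma positive_simps [simp]:
  "positive [] = []" "positive (k # ks) = (k, True) # positive ks"
  "positive (ks @ ls) = positive ks @ positive ls"
  "positive ks \<in> braid_words n \<longleftrightarrow> set ks \<subseteq> {1..<n}"
  "set (positive ks) = (\<lambda>k. (k, True)) ` set ks"
  by (auto simp: positive_def braid_words_def)

definition coxeter :: "nat \<Rightarrow> braid_word" where
  "coxeter n = positive [1..<n]"

lemma coxeter_words [simp]: "coxeter n \<in> braid_words n"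
  by (simp add: coxeter_def)

text \<open>Conjugation by \<open>\<sigma>\<^sub>1 \<dots> \<sigma>\<^sub>n\<^sub>-\<^sub>1\<close> shifts generators to the right: \<open>\<sigma>\<^sub>i\<close> passes all letters except
  \<open>\<sigma>\<^sub>i\<close> and \<open>\<sigma>\<^sub>i\<^sub>+\<^sub>1\<close>, and the braid relation carries it across these two.\<close>

lemma coxeter_letter:
  assumes "i \<in> {1..<n}" "Suc i \<in> {1..<n}"
  shows "braid_eq n (coxeter n @ [(i, True)]) ([(Suc i, True)] @ coxeter n)"
proof -
  have split: "coxeter n = positive [1..<i] @ positive [i, Suc i] @ positive [Suc (Suc i)..<n]"
    using assms upt_add_eq_append[of 1 i "n - i"]
    by (simp add: coxeter_def upt_conv_Cons del: upt_Suc)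
  have 1: "braid_eq n (positive [1..<i] @ [(Suc i, True)]) ([(Suc i, True)] @ positive [1..<i])"
    using assms by (intro far_words) auto
  have 2: "braid_eq n (positive [i, Suc i] @ [(i, True)]) ([(Suc i, True)] @ positive [i, Suc i])"
    using braid_eq.braid[OF assms] by simp
  have 3: "braid_eq n (positive [Suc (Suc i)..<n] @ [(i, True)]) ([(i, True)] @ positive [Suc (Suc i)..<n])"
    using assms by (intro far_words) auto
  show ?thesis
    unfolding split by (rule braid_eq_move[OF 1 braid_eq_move[OF 2 3]])
qed

lemma move_word:
  assumes "x \<in> braid_words n"
    and "\<And>k. k \<in> set ks \<Longrightarrow> braid_eq n (x @ [(k, True)]) ([(f k, True)] @ x)"
  shows "braid_eq n (x @ positive ks) (positive (map f ks) @ x)"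
  using assms(2)
proof (induction ks)
  case Nil
  then show ?case using assms(1) by (auto intro: braid_eq.refl)
next
  case (Cons k ks)
  have IH: "braid_eq n (x @ positive ks) (positive (map f ks) @ x)"
    using Cons by simp
  have k: "braid_eq n (x @ [(k, True)]) ([(f k, True)] @ x)"
    using Cons.prems by simp
  have 1: "braid_eq n ((x @ [(k, True)]) @ positive ks) (([(f k, True)] @ x) @ positive ks)"
    using braid_eq_words[OF IH] by (intro braid_eq.append[OF k] braid_eq.refl) auto
  have 2: "braid_eq n ([(f k, True)] @ x @ positive ks) ([(f k, True)] @ positive (map f ks) @ x)"
    using braid_eq_words[OF k] by (intro braid_eq.append[OF _ IH] braid_eq.refl) auto
  show ?case using braid_eq.trans[OF 1[unfolded append_assoc] 2] by simp
qed

text \<open>The shift stops at the last generator. The square of the Coxeter word closes the cycle: it sends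
  \<open>\<sigma>\<^sub>n\<^sub>-\<^sub>1\<close> back to \<open>\<sigma>\<^sub>1\<close>, so that the \<open>n\<close>-th power returns every generator to itself.\<close>

lemma coxeter_square_letter:
  assumes "2 \<le> n"
  shows "braid_eq n ((coxeter n @ coxeter n) @ [(n - 1, True)]) ([(1, True)] @ coxeter n @ coxeter n)"
proof -
  let ?a = "positive [1..<n - 1]" and ?b = "positive [2..<n]"
  have first: "coxeter n = [(1, True)] @ ?b"
    using assms by (simp add: coxeter_def upt_conv_Cons numeral_2_eq_2)
  have last: "coxeter n = ?a @ [(n - 1, True)]"
    using assms upt_Suc_append[of 1 "n - 1"]
    by (simp add: coxeter_def del: upt_Suc flip: positive_simps)
  have "braid_eq n (coxeter n @ ?a) (positive (map Suc [1..<n - 1]) @ coxeter n)"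
    by (intro move_word coxeter_words coxeter_letter) auto
  moreover have "map Suc [1..<n - 1] = [2..<n]"
    using assms by (simp add: map_Suc_upt numeral_2_eq_2)
  ultimately have swap: "braid_eq n (?b @ coxeter n) (coxeter n @ ?a)"
    by (auto intro: braid_eq.sym)
  \<comment> \<open>With \<open>c = \<sigma>\<^sub>1 b = a \<sigma>\<^sub>n\<^sub>-\<^sub>1\<close> and \<open>b c = c a\<close>: \<open>c c \<sigma>\<^sub>n\<^sub>-\<^sub>1 = \<sigma>\<^sub>1 b c \<sigma>\<^sub>n\<^sub>-\<^sub>1 = \<sigma>\<^sub>1 c a \<sigma>\<^sub>n\<^sub>-\<^sub>1 = \<sigma>\<^sub>1 c c\<close>.\<close>
  have "braid_eq n ([(1, True)] @ (?b @ coxeter n) @ [(n - 1, True)])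
      ([(1, True)] @ (coxeter n @ ?a) @ [(n - 1, True)])"
    using assms by (intro braid_eq_ctx[OF swap]) (auto simp: coxeter_def)
  moreover have "[(1, True)] @ (?b @ coxeter n) @ [(n - 1, True)] = (coxeter n @ coxeter n) @ [(n - 1, True)]"
    by (subst (2) first) simp
  moreover have "[(1, True)] @ (coxeter n @ ?a) @ [(n - 1, True)] = [(1, True)] @ coxeter n @ coxeter n"
    by (subst (3) last) simp
  ultimately show ?thesis by metis
qed

definition wpow :: "nat \<Rightarrow> braid_word \<Rightarrow> braid_word" where
  "wpow k w = concat (replicate k w)"

lemma wpow_simps [simp]:
  "wpow 0 w = []" "wpow (Suc k) w = w @ wpow k w"
  "w \<in> braid_words n \<Longrightarrow> wpow k w \<in> braid_words n"
  by (induction k) (auto simp: wpow_def)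

lemma wpow_add: "wpow (k + l) w = wpow k w @ wpow l w"
  by (simp add: wpow_def replicate_add)

lemma wpow_positive: "wpow k (positive ks) = positive (concat (replicate k ks))"
  by (induction k) auto

lemma coxeter_wpow_letter:
  assumes "i \<ge> 1" "i + k < n"
  shows "braid_eq n (wpow k (coxeter n) @ [(i, True)]) ([(i + k, True)] @ wpow k (coxeter n))"
  using assms(2)
proof (induction k)
  case 0
  then show ?case using assms(1) by (auto intro: braid_eq.refl)
next
  case (Suc k)
  have "braid_eq n (coxeter n @ [(i + k, True)]) ([(Suc (i + k), True)] @ coxeter n)"
    using Suc.prems assms(1) by (intro coxeter_letter) auto
  from braid_eq_move[OF this Suc.IH] Suc.prems show ?case by simp
qed

definition full_twist :: "nat \<Rightarrow> braid_word" where
  "full_twist n = wpow n (coxeter n)"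

lemma full_twist_words [simp]: "full_twist n \<in> braid_words n"
  by (simp add: full_twist_def)

lemma full_twist_letter:
  assumes "i \<in> {1..<n}"
  shows "braid_eq n (full_twist n @ [(i, b)]) ([(i, b)] @ full_twist n)"
proof -
  let ?c = "coxeter n"
  \<comment> \<open>Read from the right: \<open>n - 1 - i\<close> shifts lead from \<open>\<sigma>\<^sub>i\<close> to \<open>\<sigma>\<^sub>n\<^sub>-\<^sub>1\<close>, the square leads on to \<open>\<sigma>\<^sub>1\<close>,
    and \<open>i - 1\<close> shifts lead back to \<open>\<sigma>\<^sub>i\<close>.\<close>
  have n: "n = (i - 1) + (2 + (n - 1 - i))" using assms by auto
  have split: "full_twist n = wpow (i - 1) ?c @ (?c @ ?c) @ wpow (n - 1 - i) ?c"
    unfolding full_twist_def by (subst n) (simp only: wpow_add, simp add: numeral_2_eq_2)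
  have 1: "braid_eq n (wpow (n - 1 - i) ?c @ [(i, True)]) ([(n - 1, True)] @ wpow (n - 1 - i) ?c)"
    using coxeter_wpow_letter[of i "n - 1 - i" n] assms by simp
  have 2: "braid_eq n ((?c @ ?c) @ [(n - 1, True)]) ([(1, True)] @ (?c @ ?c))"
    using assms by (intro coxeter_square_letter) auto
  have 3: "braid_eq n (wpow (i - 1) ?c @ [(1, True)]) ([(i, True)] @ wpow (i - 1) ?c)"
    using coxeter_wpow_letter[of 1 "i - 1" n] assms by simp
  have "braid_eq n (full_twist n @ [(i, True)]) ([(i, True)] @ full_twist n)"
    unfolding split by (rule braid_eq_move[OF 3 braid_eq_move[OF 2 1]])
  with commute_winv[OF this] show ?thesis by (cases b) auto
qed

text \<open>The first letter of the Coxeter word is \<open>\<sigma>\<^sub>1\<close>; pulling it out of the \<open>i\<close>-th factor of the full twist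
  to the front turns it into \<open>\<sigma>\<^sub>i\<close>.\<close>

lemma full_twist_divisible:
  assumes "i \<in> {1..<n}"
  obtains ks where "set ks \<subseteq> {1..<n}" "braid_eq n (full_twist n) ((i, True) # positive ks)"
proof -
  define ls where "ls = concat (replicate (i - 1) [1..<n])"
  define ms where "ms = concat (replicate (n - i) [1..<n])"
  have ls: "set ls \<subseteq> {1..<n}" "wpow (i - 1) (coxeter n) = positive ls"
    and ms: "set ms \<subseteq> {1..<n}" "wpow (n - i) (coxeter n) = positive ms"
    by (auto simp: ls_def ms_def coxeter_def wpow_positive)
  have n: "n = (i - 1) + (1 + (n - i))" using assms by auto
  have "full_twist n = wpow (i - 1) (coxeter n) @ coxeter n @ wpow (n - i) (coxeter n)"
    unfolding full_twist_def by (subst n) (simp only: wpow_add, simp)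
  then have split: "full_twist n = (positive ls @ [(1, True)]) @ positive ([2..<n] @ ms)"
    unfolding ls ms using assms by (simp add: coxeter_def upt_conv_Cons numeral_2_eq_2)
  have "braid_eq n (positive ls @ [(1, True)]) ([(i, True)] @ positive ls)"
    using coxeter_wpow_letter[of 1 "i - 1" n] assms ls by simp
  then have "braid_eq n (full_twist n) (([(i, True)] @ positive ls) @ positive ([2..<n] @ ms))"
    unfolding split by (rule braid_eq.append[OF _ braid_eq.refl]) (use ms in auto)
  then show ?thesis
    using that[of "ls @ [2..<n] @ ms"] ls ms by auto
qed

text \<open>The full twist is central and positive, and it is left divisible by every generator. Each inverse
  letter of a word can therefore be absorbed by one full twist, which reduces questions about
  braids to questions about pairs of positive words.\<close>

lemma positive_up_to_full_twists:
  assumes "w \<in> braid_words n"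
  shows "\<exists>k ks. set ks \<subseteq> {1..<n} \<and> braid_eq n (wpow k (full_twist n) @ w) (positive ks)"
  using assms
proof (induction w)
  case Nil
  show ?case by (rule exI[of _ 0]) (auto intro!: exI[of _ "[]"] braid_eq.refl)
next
  case (Cons l w)
  obtain i b where l: "l = (i, b)" by (cases l)
  have i: "i \<in> {1..<n}" and w: "w \<in> braid_words n" using Cons.prems l by auto
  obtain k ks where ks: "set ks \<subseteq> {1..<n}" "braid_eq n (wpow k (full_twist n) @ w) (positive ks)"
    using Cons.IH w by blast
  have central: "braid_eq n (wpow k (full_twist n) @ positive ls) (positive ls @ wpow k (full_twist n))"
    if "set ls \<subseteq> {1..<n}" for ls
  proof (induction k)
    case 0
    show ?case using that by (auto intro: braid_eq.refl)
  next
    case (Suc k)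
    have "braid_eq n (full_twist n @ positive ls) (positive (map (\<lambda>k. k) ls) @ full_twist n)"
      using that by (intro move_word full_twist_letter full_twist_words) auto
    from braid_eq_move[OF this[simplified] Suc] show ?case by simp
  qed
  have collect: "braid_eq n (wpow k (full_twist n) @ positive ls @ w) (positive (ls @ ks))"
    if ls: "set ls \<subseteq> {1..<n}" for ls
  proof -
    have 1: "braid_eq n ((wpow k (full_twist n) @ positive ls) @ w) ((positive ls @ wpow k (full_twist n)) @ w)"
      using ls w by (intro braid_eq.append central braid_eq.refl) auto
    have 2: "braid_eq n (positive ls @ (wpow k (full_twist n) @ w)) (positive ls @ positive ks)"
      using ls by (intro braid_eq.append ks braid_eq.refl) auto
    show ?thesis using braid_eq.trans[OF 1[unfolded append_assoc] 2] by simp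
  qed
  show ?case
  proof (cases b)
    case True
    with collect[of "[i]"] i ks(1) show ?thesis
      by (intro exI[of _ k] exI[of _ "i # ks"]) (auto simp: l)
  next
    case False
    obtain ls where ls: "set ls \<subseteq> {1..<n}" "braid_eq n (full_twist n) ((i, True) # positive ls)"
      using full_twist_divisible[OF i] .
    have 1: "braid_eq n (full_twist n @ [(i, False)]) ([(i, False)] @ full_twist n)"
      by (rule full_twist_letter[OF i])
    have 2: "braid_eq n ([(i, False)] @ full_twist n) ([(i, False)] @ (i, True) # positive ls)"
      using i by (intro braid_eq.append ls braid_eq.refl) auto
    have 3: "braid_eq n ([(i, False), (i, True)] @ positive ls) ([] @ positive ls)"
      using i ls(1) braid_eq.cancel[of i n False] by (intro braid_eq.append braid_eq.refl) auto
    have 4: "braid_eq n (full_twist n @ [(i, False)]) (positive ls)"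
      using braid_eq.trans[OF 1 braid_eq.trans[OF 2]] 3 by simp
    have 5: "braid_eq n (wpow k (full_twist n) @ (full_twist n @ [(i, False)]) @ w)
        (wpow k (full_twist n) @ positive ls @ w)"
      using i w by (intro braid_eq_ctx[OF 4]) auto
    have "wpow (Suc k) (full_twist n) = wpow k (full_twist n) @ full_twist n"
      using wpow_add[of k 1 "full_twist n"] by simp
    with braid_eq.trans[OF 5 collect[OF ls(1)]]
    have "braid_eq n (wpow (Suc k) (full_twist n) @ l # w) (positive (ls @ ks))"
      by (simp add: l False)
    moreover have "set (ls @ ks) \<subseteq> {1..<n}" using ls ks by auto
    ultimately show ?thesis by blast
  qed
qed

lemma full_twist_power_positive:
  "\<exists>ks. set ks \<subseteq> {1..<n} \<and> wpow k (full_twist n) = positive ks"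
  unfolding full_twist_def coxeter_def wpow_positive
  by (intro exI[of _ "concat (replicate k (concat (replicate n [1..<n])))"]) auto

section \<open>The two-particle representation of the Temperley-Lieb algebra\<close>

type_synonym obs = "nat \<Rightarrow> nat \<Rightarrow> ratfun"

text \<open>A function of two positions \<open>p < q\<close> is a vector in the weight space of \<open>(\<complex>\<^sup>2)\<^sup>\<otimes>\<^sup>N\<close> with two spins
  down, at \<open>p\<close> and \<open>q\<close>; the basis is rescaled so that \<open>e\<^sub>i\<close> annihilates the constants.
  The value 0 at arguments that are not increasing makes the relations hold for all arguments.\<close>

definition tl_act :: "nat \<Rightarrow> obs \<Rightarrow> obs" where
  "tl_act i g p q =
    (if q \<le> p then 0
     else if p = i \<and> q \<noteq> Suc i then inverse A_var ^ 2 * (g (Suc i) q - g i q)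
     else if p = Suc i then A_var ^ 2 * (g i q - g (Suc i) q)
     else if q = i then inverse A_var ^ 2 * (g p (Suc i) - g p i)
     else if q = Suc i \<and> p \<noteq> i then A_var ^ 2 * (g p i - g p (Suc i))
     else 0)"

lemma tl_act_square: "tl_act i (tl_act i g) = (\<lambda>p q. loop_value * tl_act i g p q)"
  by (intro ext) (auto simp: tl_act_def loop_value_def algebra_simps)

lemma tl_act_far:
  assumes "i + 2 \<le> j \<or> j + 2 \<le> i"
  shows "tl_act i (tl_act j g) = tl_act j (tl_act i g)"
proof -
  have "tl_act i (tl_act j g) p q = tl_act j (tl_act i g) p q" if ij: "Suc i < j" for i j p q
  proof -
    have cases: "p = i \<or> p = Suc i \<or> p = j \<or> p = Suc j \<or> p \<notin> {i, Suc i, j, Suc j}" for p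
      by auto
    show ?thesis
      using cases[of p] cases[of q] ij
      by (elim disjE) (simp_all add: tl_act_def right_diff_distrib mult.left_commute)
  qed
  from this[of i j] this[of j i] assms show ?thesis by (auto simp: fun_eq_iff)
qed

lemma inverse_A_var_square:
  "inverse A_var ^ 2 * (A_var ^ 2 * x) = x" "A_var ^ 2 * (inverse A_var ^ 2 * x) = x"
  by (simp_all add: A_var_nonzero mult.assoc[symmetric] power_mult_distrib[symmetric])

lemma tl_act_adjacent:
  "tl_act i (tl_act (Suc i) (tl_act i g)) = tl_act i g"
  "tl_act (Suc i) (tl_act i (tl_act (Suc i) g)) = tl_act (Suc i) g"
proof -
  have cases: "p = i \<or> p = Suc i \<or> p = Suc (Suc i) \<or> p \<notin> {i, Suc i, Suc (Suc i)}" for p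
    by auto
  show "tl_act i (tl_act (Suc i) (tl_act i g)) = tl_act i g"
  proof (intro ext)
    fix p q
    show "tl_act i (tl_act (Suc i) (tl_act i g)) p q = tl_act i g p q"
      using cases[of p] cases[of q]
      by (elim disjE) (simp_all add: tl_act_def right_diff_distrib inverse_A_var_square)
  qed
  show "tl_act (Suc i) (tl_act i (tl_act (Suc i) g)) = tl_act (Suc i) g"
  proof (intro ext)
    fix p q
    show "tl_act (Suc i) (tl_act i (tl_act (Suc i) g)) p q = tl_act (Suc i) g p q"
      using cases[of p] cases[of q]
      by (elim disjE) (simp_all add: tl_act_def right_diff_distrib inverse_A_var_square)
  qed
qed

definition tl_word_act :: "tl_word \<Rightarrow> obs \<Rightarrow> obs" where
  "tl_word_act w = foldr tl_act (letters w)"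

definition tl_poly_act :: "tl_poly \<Rightarrow> obs \<Rightarrow> obs" where
  "tl_poly_act f g p q = (\<Sum>w\<in>Poly_Mapping.keys f. Poly_Mapping.lookup f w * tl_word_act w g p q)"

lemma tl_act_sum:
  "tl_act i (\<lambda>p q. \<Sum>x\<in>X. c x * G x p q) = (\<lambda>p q. \<Sum>x\<in>X. c x * tl_act i (G x) p q)"
  by (intro ext)
    (auto simp: tl_act_def sum_distrib_left sum_subtractf[symmetric] algebra_simps intro!: sum.cong)

lemma tl_word_act_sum:
  "tl_word_act w (\<lambda>p q. \<Sum>x\<in>X. c x * G x p q) = (\<lambda>p q. \<Sum>x\<in>X. c x * tl_word_act w (G x) p q)"
proof -
  have "foldr tl_act l (\<lambda>p q. \<Sum>x\<in>X. c x * G x p q) = (\<lambda>p q. \<Sum>x\<in>X. c x * foldr tl_act l (G x) p q)" for l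
    by (induction l) (simp_all add: tl_act_sum)
  then show ?thesis by (simp add: tl_word_act_def)
qed

lemma tl_poly_act_superset:
  assumes "finite X" "Poly_Mapping.keys f \<subseteq> X"
  shows "tl_poly_act f g p q = (\<Sum>w\<in>X. Poly_Mapping.lookup f w * tl_word_act w g p q)"
  unfolding tl_poly_act_def using assms
  by (intro sum.mono_neutral_left) (auto simp: in_keys_iff)

lemma tl_poly_act_add: "tl_poly_act (f + f') g p q = tl_poly_act f g p q + tl_poly_act f' g p q"
proof -
  let ?X = "Poly_Mapping.keys f \<union> Poly_Mapping.keys f'"
  have "Poly_Mapping.keys (f + f') \<subseteq> ?X" by (rule Poly_Mapping.keys_add)
  then show ?thesis
    by (simp add: tl_poly_act_superset[of ?X] lookup_add distrib_right sum.distrib)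
qed

lemma tl_poly_act_uminus: "tl_poly_act (- f) g p q = - tl_poly_act f g p q"
  by (simp add: tl_poly_act_def sum_negf)

lemma tl_poly_act_diff: "tl_poly_act (f - f') g p q = tl_poly_act f g p q - tl_poly_act f' g p q"
  using tl_poly_act_add[of f "- f'"] tl_poly_act_uminus[of f'] by simp

lemma tl_poly_act_0: "tl_poly_act 0 g p q = 0"
  by (simp add: tl_poly_act_def)

lemma tl_poly_act_single:
  "tl_poly_act (Poly_Mapping.single w a) g p q = a * tl_word_act w g p q"
  by (simp add: tl_poly_act_def)

lemma tl_poly_act_sum: "tl_poly_act (sum F X) g p q = (\<Sum>x\<in>X. tl_poly_act (F x) g p q)"
  by (induction X rule: infinite_finite_induct) (simp_all add: tl_poly_act_add tl_poly_act_0)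

lemma tl_poly_act_base:
  "tl_poly_act 1 g = g" "tl_poly_act (scal a) g p q = a * g p q" "tl_poly_act (gen i) g = tl_act i g"
proof -
  show *: "tl_poly_act (scal a) g p q = a * g p q" for a p q
    by (simp add: scal_def tl_poly_act_single tl_word_act_def zero_tl_word_def)
  show "tl_poly_act 1 g = g"
    using *[of 1] by (intro ext) (simp add: scal_simps)
  show "tl_poly_act (gen i) g = tl_act i g"
    by (intro ext) (simp add: gen_def tl_poly_act_single tl_word_act_def)
qed

lemma poly_mapping_as_sum:
  "f = (\<Sum>w\<in>Poly_Mapping.keys f. Poly_Mapping.single w (Poly_Mapping.lookup f w))"
proof (rule poly_mapping_eqI)
  fix k
  show "Poly_Mapping.lookup f k =
      Poly_Mapping.lookup (\<Sum>w\<in>Poly_Mapping.keys f. Poly_Mapping.single w (Poly_Mapping.lookup f w)) k"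
    by (cases "k \<in> Poly_Mapping.keys f")
      (auto simp: lookup_sum lookup_single when_def in_keys_iff)
qed

lemma tl_poly_act_mult: "tl_poly_act (f * f') g = tl_poly_act f (tl_poly_act f' g)"
proof (intro ext)
  fix p q
  let ?a = "Poly_Mapping.lookup f" and ?b = "Poly_Mapping.lookup f'"
  let ?X = "Poly_Mapping.keys f" and ?Y = "Poly_Mapping.keys f'"
  have "f * f' = (\<Sum>u\<in>?X. Poly_Mapping.single u (?a u)) * (\<Sum>v\<in>?Y. Poly_Mapping.single v (?b v))"
    using poly_mapping_as_sum[of f] poly_mapping_as_sum[of f'] by simp
  also have "\<dots> = (\<Sum>u\<in>?X. \<Sum>v\<in>?Y. Poly_Mapping.single (u + v) (?a u * ?b v))"
    by (simp add: sum_product mult_single)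
  finally have "tl_poly_act (f * f') g p q = (\<Sum>u\<in>?X. \<Sum>v\<in>?Y. ?a u * ?b v * tl_word_act (u + v) g p q)"
    by (simp add: tl_poly_act_sum tl_poly_act_single)
  also have "\<dots> = (\<Sum>u\<in>?X. ?a u * (\<Sum>v\<in>?Y. ?b v * tl_word_act u (tl_word_act v g) p q))"
    by (simp add: tl_word_act_def plus_tl_word_def sum_distrib_left mult.assoc)
  also have "\<dots> = (\<Sum>u\<in>?X. ?a u * tl_word_act u (tl_poly_act f' g) p q)"
    unfolding tl_poly_act_def[abs_def] tl_word_act_sum ..
  also have "\<dots> = tl_poly_act f (tl_poly_act f' g) p q"
    by (simp add: tl_poly_act_def)
  finally show "tl_poly_act (f * f') g p q = tl_poly_act f (tl_poly_act f' g) p q" .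
qed

lemma tl_poly_act_zero_obs: "tl_poly_act f (\<lambda>p q. 0) = (\<lambda>p q. 0)"
proof -
  have "tl_word_act w (\<lambda>p q. 0) = (\<lambda>p q. 0)" for w
    using tl_word_act_sum[of w "\<lambda>_. 0" "\<lambda>_ _ _. 0" "{}"] by simp
  then show ?thesis by (intro ext) (simp add: tl_poly_act_def)
qed

text \<open>The polynomials that act as zero form an ideal, and it contains the relators.\<close>

lemma tl_ideal_acts_trivially:
  assumes "f \<in> tl_ideal N"
  shows "tl_poly_act f g = (\<lambda>p q. 0)"
proof -
  let ?I = "{f \<in> carrier (free_alg N). \<forall>g. tl_poly_act f g = (\<lambda>p q. 0)}"
  have "ideal ?I (free_alg N)"
  proof (rule idealI)
    show "ring (free_alg N)" by (rule ring_free_alg)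
    show "subgroup ?I (add_monoid (free_alg N))"
    proof (rule group.subgroupI)
      show "Group.group (add_monoid (free_alg N))"
        using ring_free_alg abelian_group.a_group ring.is_abelian_group by blast
      show "?I \<noteq> {}" using free_alg_base(1)[of N] tl_poly_act_0 by fastforce
      fix x assume x: "x \<in> ?I"
      interpret ring "free_alg N" by (rule ring_free_alg)
      have inv: "inv\<^bsub>add_monoid (free_alg N)\<^esub> x = - x"
        unfolding a_inv_def[symmetric] using x free_alg_closed(4)[of x N]
        by (intro minus_equality) auto
      show "inv\<^bsub>add_monoid (free_alg N)\<^esub> x \<in> ?I"
        unfolding inv using x by (auto simp: free_alg_closed fun_eq_iff tl_poly_act_uminus)
    qed (auto simp: free_alg_closed fun_eq_iff tl_poly_act_add)
  qed (auto simp: free_alg_closed tl_poly_act_mult tl_poly_act_zero_obs)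
  moreover have "tl_poly_act f g = (\<lambda>p q. 0)" if "f \<in> tl_relators N" for f g
    using that unfolding tl_relators_def
    by (auto simp: fun_eq_iff tl_poly_act_diff tl_poly_act_mult tl_poly_act_base tl_act_square
        tl_act_adjacent tl_act_far)
  then have "tl_relators N \<subseteq> ?I"
    using tl_relators_carrier[of N] by blast
  ultimately have "tl_ideal N \<subseteq> ?I"
    unfolding tl_ideal_def by (intro ring.genideal_minimal[OF ring_free_alg])
  then show ?thesis using assms by blast
qed

text \<open>This is \<open>A\<^sup>-\<^sup>1 \<sigma>\<^sub>i\<close> for \<open>\<tau> = A\<^sup>-\<^sup>4\<close>. For \<open>0 \<le> \<tau> \<le> 1\<close> it is the expectation of \<open>g\<close> after one step of an
  asymmetric exclusion process: a particle at \<open>i\<close> with a free right neighbour moves there with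
  probability \<open>\<tau>\<close>, a particle at \<open>i + 1\<close> with a free left neighbour moves there for certain.\<close>

definition hop :: "'a::comm_ring_1 \<Rightarrow> nat \<Rightarrow> (nat \<Rightarrow> nat \<Rightarrow> 'a) \<Rightarrow> nat \<Rightarrow> nat \<Rightarrow> 'a" where
  "hop \<tau> i g p q =
    (if q \<le> p then g p q
     else if p = i \<and> q \<noteq> Suc i then (1 - \<tau>) * g i q + \<tau> * g (Suc i) q
     else if p = Suc i then g i q
     else if q = i then (1 - \<tau>) * g p i + \<tau> * g p (Suc i)
     else if q = Suc i \<and> p \<noteq> i then g p i
     else g p q)"

text \<open>The steps are performed in the order in which the word is read.\<close>

definition hops :: "'a::comm_ring_1 \<Rightarrow> braid_word \<Rightarrow> (nat \<Rightarrow> nat \<Rightarrow> 'a) \<Rightarrow> nat \<Rightarrow> nat \<Rightarrow> 'a" where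
  "hops \<tau> w = foldr (\<lambda>l. hop \<tau> (fst l)) w"

lemma hops_simps [simp]:
  "hops \<tau> [] g = g" "hops \<tau> (l # w) g = hop \<tau> (fst l) (hops \<tau> w g)"
  "hops \<tau> (v @ w) g = hops \<tau> v (hops \<tau> w g)"
  by (simp_all add: hops_def)

lemma hop_scale: "hop \<tau> i (\<lambda>p q. c * g p q) p q = c * hop \<tau> i g p q"
  by (simp add: hop_def algebra_simps)

lemma jones_letter_act:
  "tl_poly_act (jones_letter (i, True)) g = (\<lambda>p q. A_var * hop (inverse A_var ^ 4) i g p q)"
proof (intro ext)
  fix p q
  have A: "inverse A_var * A_var ^ 2 = A_var"
    "inverse A_var * inverse A_var ^ 2 = A_var * inverse A_var ^ 4"
    using A_var_nonzero by (simp_all add: field_simps power2_eq_square power4_eq_xxxx)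
  have A': "inverse A_var * (A_var ^ 2 * x) = A_var * x"
    "inverse A_var * (inverse A_var ^ 2 * x) = A_var * (inverse A_var ^ 4 * x)" for x
    by (simp_all only: mult.assoc[symmetric] A)
  have "tl_poly_act (jones_letter (i, True)) g p q = A_var * g p q + inverse A_var * tl_act i g p q"
    by (simp add: tl_poly_act_add tl_poly_act_mult tl_poly_act_base)
  also have "\<dots> = A_var * hop (inverse A_var ^ 4) i g p q"
    by (simp only: tl_act_def hop_def if_distrib[of "\<lambda>x. inverse A_var * x"] A' cong: if_cong)
      (simp add: algebra_simps)
  finally show "tl_poly_act (jones_letter (i, True)) g p q = A_var * hop (inverse A_var ^ 4) i g p q" .
qed

lemma jones_letters_act:
  assumes "\<forall>l\<in>set w. snd l"
  shows "tl_poly_act (prod_list (map jones_letter w)) g =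
    (\<lambda>p q. A_var ^ length w * hops (inverse A_var ^ 4) w g p q)"
  using assms
proof (induction w)
  case Nil
  show ?case by (simp add: tl_poly_act_base)
next
  case (Cons l w)
  then obtain i where l: "l = (i, True)" by (cases l) auto
  have "tl_poly_act (prod_list (map jones_letter (l # w))) g =
      tl_poly_act (jones_letter l) (\<lambda>p q. A_var ^ length w * hops (inverse A_var ^ 4) w g p q)"
    using Cons by (simp add: tl_poly_act_mult)
  then show ?case by (simp add: l jones_letter_act hop_scale mult.assoc del: jones_letter.simps)
qed

lemma tl_class_eq_imp:
  assumes "x \<in> carrier (free_alg N)" "y \<in> carrier (free_alg N)" "tl_class N x = tl_class N y"
  shows "x - y \<in> tl_ideal N"
proof -
  interpret ideal "tl_ideal N" "free_alg N" by (rule ideal_tl_ideal)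
  have "x \<in> tl_class N x"
    unfolding tl_class_def by (rule a_rcos_self[OF assms(1)])
  then have "x \<in> tl_class N y" by (simp only: assms(3))
  then obtain h where "h \<in> tl_ideal N" "x = h + y"
    unfolding tl_class_def a_r_coset_def' by auto
  then show ?thesis by simp
qed

lemma hops_const: "hops \<tau> w (\<lambda>p q. c) = (\<lambda>p q. c)"
  by (induction w) (auto simp: hop_def fun_eq_iff algebra_simps)

text \<open>The factors \<open>A\<close> that distinguish \<open>\<sigma>\<^sub>i\<close> from \<open>hop\<close> are harmless: the constant function is fixed by
  \<open>hop\<close>, so it reveals the number of crossings.\<close>

lemma jones_word_eq_imp_hops_eq:
  assumes "u \<in> braid_words N" "v \<in> braid_words N" "\<forall>l\<in>set u. snd l" "\<forall>l\<in>set v. snd l"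
    and "jones_word N u = jones_word N v"
  shows "hops (inverse A_var ^ 4) u = hops (inverse A_var ^ 4) v"
proof -
  let ?\<tau> = "inverse A_var ^ 4"
  have "prod_list (map jones_letter u) - prod_list (map jones_letter v) \<in> tl_ideal N"
    using assms jones_word_tl_class[of u N] jones_word_tl_class[of v N] by (intro tl_class_eq_imp) auto
  then have "tl_poly_act (prod_list (map jones_letter u) - prod_list (map jones_letter v)) g p q = 0" for g p q
    by (simp add: tl_ideal_acts_trivially)
  then have eq: "A_var ^ length u * hops ?\<tau> u g p q = A_var ^ length v * hops ?\<tau> v g p q" for g p q
    using assms(3,4) by (simp add: tl_poly_act_diff jones_letters_act)
  have "A_var ^ length u = A_var ^ length v"
    using eq[of "\<lambda>p q. 1"] by (simp add: hops_const)
  with eq A_var_nonzero show ?thesis by (auto simp: fun_eq_iff)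
qed

section \<open>Crossings of cables\<close>

context
  fixes \<tau> :: "'a::comm_ring_1"
begin

abbreviation row :: "nat \<Rightarrow> nat \<Rightarrow> (nat \<Rightarrow> nat \<Rightarrow> 'a) \<Rightarrow> nat \<Rightarrow> nat \<Rightarrow> 'a" where
  "row s a \<equiv> hops \<tau> (braid_row True s a)"

text \<open>In \<open>braid_row True s a\<close> one strand passes from \<open>s + a + 1\<close> to \<open>s + 1\<close>. A particle among the \<open>a\<close> strands
  that it meets either escapes by one place to the right, with probability \<open>\<tau>\<close>, or is picked up and
  carried to \<open>s + 1\<close>. A strand that carries a particle cannot take it past a second one at \<open>p\<close>:
  it drops the first at \<open>p + 1\<close> and carries the second one on.\<close>

lemma row_outside:
  assumes "p < q" "p \<le> s \<or> s + a + 1 < p" "q \<le> s \<or> s + a + 1 < q"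
  shows "row s a g p q = g p q"
  using assms
proof (induction a)
  case (Suc a)
  then have "row s a g p q = g p q" by auto
  then show ?case using Suc.prems by (auto simp: row_Suc hop_def)
qed simp

lemma row_low_last:
  assumes "s + a + 1 < q"
  shows "row s a g (Suc (s + a)) q = g (Suc s) q"
  using assms by (induction a) (auto simp: row_Suc hop_def)

lemma row_low:
  assumes "s < p" "p \<le> s + a" "s + a + 1 < q"
  shows "row s a g p q = \<tau> * g (Suc p) q + (1 - \<tau>) * g (Suc s) q"
  using assms
proof (induction a)
  case (Suc a)
  show ?case
  proof (cases "p = Suc (s + a)")
    case True
    then show ?thesis using Suc.prems row_low_last[of s a q g] row_outside[of "Suc p" q s a g]
      by (simp add: row_Suc hop_def)
  next
    case False
    then show ?thesis using Suc by (simp add: row_Suc hop_def)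
  qed
qed simp

lemma row_high_last:
  assumes "p \<le> s"
  shows "row s a g p (Suc (s + a)) = g p (Suc s)"
  using assms by (induction a) (auto simp: row_Suc hop_def)

lemma row_high:
  assumes "p \<le> s" "s < q" "q \<le> s + a"
  shows "row s a g p q = \<tau> * g p (Suc q) + (1 - \<tau>) * g p (Suc s)"
  using assms
proof (induction a)
  case (Suc a)
  show ?case
  proof (cases "q = Suc (s + a)")
    case True
    then show ?thesis using Suc.prems row_high_last[of p s a g] row_outside[of p "Suc q" s a g]
      by (simp add: row_Suc hop_def)
  next
    case False
    then show ?thesis using Suc by (simp add: row_Suc hop_def)
  qed
qed simp

lemma row_both_last:
  assumes "s < p" "p \<le> s + a"
  shows "row s a g p (Suc (s + a)) = g (Suc s) (Suc p)"
  using assms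
proof (induction a)
  case (Suc a)
  show ?case
  proof (cases "p = Suc (s + a)")
    case True
    then show ?thesis using row_low_last[of s a "Suc p" g] by (simp add: row_Suc hop_def)
  next
    case False
    then show ?thesis using Suc by (simp add: row_Suc hop_def)
  qed
qed simp

lemma row_both:
  assumes "s < p" "p < q" "q \<le> s + a"
  shows "row s a g p q = \<tau> * (\<tau> * g (Suc p) (Suc q) + (1 - \<tau>) * g (Suc s) (Suc q))
    + (1 - \<tau>) * g (Suc s) (Suc p)"
  using assms
proof (induction a)
  case (Suc a)
  show ?case
  proof (cases "q = Suc (s + a)")
    case True
    then show ?thesis using Suc.prems row_both_last[of s p a g] row_low[of s p a "Suc q" g]
      by (simp add: row_Suc hop_def)
  next
    case False
    then show ?thesis using Suc by (simp add: row_Suc hop_def)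
  qed
qed simp

lemma block_Suc_first: "block b s a (Suc q) = braid_row b s a @ block b (Suc s) a q"
  using block_append[of b s a 1 q] by (simp add: block_Suc)

abbreviation cross :: "nat \<Rightarrow> nat \<Rightarrow> nat \<Rightarrow> (nat \<Rightarrow> nat \<Rightarrow> 'a) \<Rightarrow> nat \<Rightarrow> nat \<Rightarrow> 'a" where
  "cross s a m \<equiv> hops \<tau> (block True s a m)"

text \<open>In a crossing of \<open>a\<close> strands with \<open>m\<close> strands, a single particle on the left must escape \<open>m\<close> times in order
  to stay on its strand; once picked up it has reached its final position. Hence the position of
  the particle within its cable is irrelevant, and functions that depend only on the cables of the
  two particles are mapped to functions of the same kind.\<close>

lemma cross_outside:
  assumes "p < q" "p \<le> s \<or> s + a + m < p" "q \<le> s \<or> s + a + m < q"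
  shows "cross s a m g p q = g p q"
  using assms
proof (induction m arbitrary: s)
  case (Suc m)
  then have "cross (Suc s) a m g p q = g p q" by (intro Suc.IH) auto
  then show ?case using Suc.prems by (auto simp: block_Suc_first row_outside)
qed simp

lemma cross_low:
  assumes "\<And>x. s < x \<Longrightarrow> x \<le> s + m \<Longrightarrow> g x z = L"
    and "\<And>x. s + m < x \<Longrightarrow> x \<le> s + m + a \<Longrightarrow> g x z = R"
    and "s + a + m < z"
  shows "s < p \<Longrightarrow> p \<le> s + a \<Longrightarrow> cross s a m g p z = (1 - \<tau> ^ m) * L + \<tau> ^ m * R"
    and "s + a < p \<Longrightarrow> p \<le> s + a + m \<Longrightarrow> cross s a m g p z = L"
proof -
  have "(s < p \<longrightarrow> p \<le> s + a \<longrightarrow> cross s a m g p z = (1 - \<tau> ^ m) * L + \<tau> ^ m * R) \<and>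
      (s + a < p \<longrightarrow> p \<le> s + a + m \<longrightarrow> cross s a m g p z = L)"
    using assms
  proof (induction m arbitrary: s p)
    case (Suc m)
    have IH: "Suc s < p \<Longrightarrow> p \<le> Suc s + a \<Longrightarrow> cross (Suc s) a m g p z = (1 - \<tau> ^ m) * L + \<tau> ^ m * R"
      "Suc s + a < p \<Longrightarrow> p \<le> Suc s + a + m \<Longrightarrow> cross (Suc s) a m g p z = L" for p
      using Suc.IH[of "Suc s" p] Suc.prems by auto
    have out: "cross (Suc s) a m g (Suc s) z = L"
      using Suc.prems by (subst cross_outside) auto
    have 1: "cross s a (Suc m) g p z = (1 - \<tau> ^ Suc m) * L + \<tau> ^ Suc m * R"
      if "s < p" "p \<le> s + a"
    proof -
      have "cross s a (Suc m) g p z = \<tau> * cross (Suc s) a m g (Suc p) z + (1 - \<tau>) * L"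
        using that out Suc.prems(3) by (simp add: block_Suc_first row_low)
      then show ?thesis using that IH(1)[of "Suc p"] by (simp add: algebra_simps)
    qed
    have 2: "cross s a (Suc m) g p z = L" if "s + a < p" "p \<le> s + a + Suc m"
    proof (cases "p = Suc (s + a)")
      case True
      then show ?thesis using out Suc.prems(3) by (simp add: block_Suc_first row_low_last)
    next
      case False
      then show ?thesis using that IH(2)[of p] Suc.prems(3) by (simp add: block_Suc_first row_outside)
    qed
    show ?case using 1 2 by blast
  qed simp
  then show "s < p \<Longrightarrow> p \<le> s + a \<Longrightarrow> cross s a m g p z = (1 - \<tau> ^ m) * L + \<tau> ^ m * R"
    and "s + a < p \<Longrightarrow> p \<le> s + a + m \<Longrightarrow> cross s a m g p z = L" by blast+
qed

lemma cross_high: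
  assumes "\<And>x. s < x \<Longrightarrow> x \<le> s + m \<Longrightarrow> g z x = L"
    and "\<And>x. s + m < x \<Longrightarrow> x \<le> s + m + a \<Longrightarrow> g z x = R"
    and "z \<le> s"
  shows "s < p \<Longrightarrow> p \<le> s + a \<Longrightarrow> cross s a m g z p = (1 - \<tau> ^ m) * L + \<tau> ^ m * R"
    and "s + a < p \<Longrightarrow> p \<le> s + a + m \<Longrightarrow> cross s a m g z p = L"
proof -
  have "(s < p \<longrightarrow> p \<le> s + a \<longrightarrow> cross s a m g z p = (1 - \<tau> ^ m) * L + \<tau> ^ m * R) \<and>
      (s + a < p \<longrightarrow> p \<le> s + a + m \<longrightarrow> cross s a m g z p = L)"
    using assms
  proof (induction m arbitrary: s p)
    case (Suc m)
    have IH: "Suc s < p \<Longrightarrow> p \<le> Suc s + a \<Longrightarrow> cross (Suc s) a m g z p = (1 - \<tau> ^ m) * L + \<tau> ^ m * R"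
      "Suc s + a < p \<Longrightarrow> p \<le> Suc s + a + m \<Longrightarrow> cross (Suc s) a m g z p = L" for p
      using Suc.IH[of "Suc s" p] Suc.prems by auto
    have out: "cross (Suc s) a m g z (Suc s) = L"
      using Suc.prems by (subst cross_outside) auto
    have 1: "cross s a (Suc m) g z p = (1 - \<tau> ^ Suc m) * L + \<tau> ^ Suc m * R"
      if "s < p" "p \<le> s + a"
    proof -
      have "cross s a (Suc m) g z p = \<tau> * cross (Suc s) a m g z (Suc p) + (1 - \<tau>) * L"
        using that out Suc.prems(3) by (simp add: block_Suc_first row_high)
      then show ?thesis using that IH(1)[of "Suc p"] by (simp add: algebra_simps)
    qed
    have 2: "cross s a (Suc m) g z p = L" if "s + a < p" "p \<le> s + a + Suc m"
    proof (cases "p = Suc (s + a)")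
      case True
      then show ?thesis using out Suc.prems(3) by (simp add: block_Suc_first row_high_last)
    next
      case False
      then show ?thesis using that IH(2)[of p] Suc.prems(3) by (simp add: block_Suc_first row_outside)
    qed
    show ?case using 1 2 by blast
  qed simp
  then show "s < p \<Longrightarrow> p \<le> s + a \<Longrightarrow> cross s a m g z p = (1 - \<tau> ^ m) * L + \<tau> ^ m * R"
    and "s + a < p \<Longrightarrow> p \<le> s + a + m \<Longrightarrow> cross s a m g z p = L" by blast+
qed

text \<open>If both particles start in the left cable, a strand that carries one of them away shifts the other
  one place to the right, just as an escape does. The other can therefore be picked up only by the
  remaining \<open>m - 1\<close> strands. The same happens at the strand that brings a particle from the right
  cable, if it meets the other particle still on the left.\<close>

lemma cross_both:
  assumes "\<And>x y. s < x \<Longrightarrow> x < y \<Longrightarrow> y \<le> s + m \<Longrightarrow> g x y = LL"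
    and "\<And>x y. s < x \<Longrightarrow> x \<le> s + m \<Longrightarrow> s + m < y \<Longrightarrow> y \<le> s + m + a \<Longrightarrow> g x y = LR"
    and "\<And>x y. s + m < x \<Longrightarrow> x < y \<Longrightarrow> y \<le> s + m + a \<Longrightarrow> g x y = RR"
  shows "s < p \<Longrightarrow> p < q \<Longrightarrow> q \<le> s + a \<Longrightarrow> cross s a m g p q =
      \<tau> ^ m * \<tau> ^ m * RR + (1 - \<tau> ^ m) * (\<tau> ^ m + \<tau> ^ (m - 1)) * LR
      + (1 - \<tau> ^ m) * (1 - \<tau> ^ (m - 1)) * LL"
    and "s < p \<Longrightarrow> p \<le> s + a \<Longrightarrow> s + a < q \<Longrightarrow> q \<le> s + a + m \<Longrightarrow> cross s a m g p q =
      \<tau> ^ (m - 1) * LR + (1 - \<tau> ^ (m - 1)) * LL"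
    and "s + a < p \<Longrightarrow> p < q \<Longrightarrow> q \<le> s + a + m \<Longrightarrow> cross s a m g p q = LL"
proof -
  have "(s < p \<longrightarrow> p < q \<longrightarrow> q \<le> s + a \<longrightarrow> cross s a m g p q =
      \<tau> ^ m * \<tau> ^ m * RR + (1 - \<tau> ^ m) * (\<tau> ^ m + \<tau> ^ (m - 1)) * LR
      + (1 - \<tau> ^ m) * (1 - \<tau> ^ (m - 1)) * LL) \<and>
    (s < p \<longrightarrow> p \<le> s + a \<longrightarrow> s + a < q \<longrightarrow> q \<le> s + a + m \<longrightarrow> cross s a m g p q =
      \<tau> ^ (m - 1) * LR + (1 - \<tau> ^ (m - 1)) * LL) \<and>
    (s + a < p \<longrightarrow> p < q \<longrightarrow> q \<le> s + a + m \<longrightarrow> cross s a m g p q = LL)"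
    using assms
  proof (induction m arbitrary: s p q)
    case (Suc m)
    let ?t = "\<tau> ^ m"
    have IH1: "Suc s < p \<Longrightarrow> p < q \<Longrightarrow> q \<le> Suc s + a \<Longrightarrow> cross (Suc s) a m g p q =
      ?t * ?t * RR + (1 - ?t) * (?t + \<tau> ^ (m - 1)) * LR + (1 - ?t) * (1 - \<tau> ^ (m - 1)) * LL"
      and IH2: "Suc s < p \<Longrightarrow> p \<le> Suc s + a \<Longrightarrow> Suc s + a < q \<Longrightarrow> q \<le> Suc s + a + m \<Longrightarrow>
        cross (Suc s) a m g p q = \<tau> ^ (m - 1) * LR + (1 - \<tau> ^ (m - 1)) * LL"
      and IH3: "Suc s + a < p \<Longrightarrow> p < q \<Longrightarrow> q \<le> Suc s + a + m \<Longrightarrow> cross (Suc s) a m g p q = LL" for p q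
      using Suc.IH[of "Suc s" p q] Suc.prems by auto
    have dep1: "cross (Suc s) a m g (Suc s) y = (1 - ?t) * LL + ?t * LR" if "Suc s < y" "y \<le> Suc s + a" for y
      using Suc.prems that by (intro cross_high(1)) auto
    have dep2: "cross (Suc s) a m g (Suc s) y = LL" if "Suc s + a < y" "y \<le> Suc s + a + m" for y
      using Suc.prems that by (intro cross_high(2)[where R = LR]) auto
    \<comment> \<open>For \<open>m = 0\<close> the truncated exponent \<open>m - 1\<close> is harmless, since the factor \<open>1 - \<tau>\<^sup>m\<close> vanishes.\<close>
    have pow: "(1 - ?t) * (\<tau> * \<tau> ^ (m - 1)) = (1 - ?t) * ?t"
      by (cases m) auto
    have 1: "cross s a (Suc m) g p q =
      \<tau> ^ Suc m * \<tau> ^ Suc m * RR + (1 - \<tau> ^ Suc m) * (\<tau> ^ Suc m + ?t) * LR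
      + (1 - \<tau> ^ Suc m) * (1 - ?t) * LL" if "s < p" "p < q" "q \<le> s + a"
    proof -
      have "cross s a (Suc m) g p q =
          \<tau> * (\<tau> * cross (Suc s) a m g (Suc p) (Suc q) + (1 - \<tau>) * ((1 - ?t) * LL + ?t * LR))
          + (1 - \<tau>) * ((1 - ?t) * LL + ?t * LR)"
        using that dep1[of "Suc p"] dep1[of "Suc q"] by (simp add: block_Suc_first row_both)
      also have "cross (Suc s) a m g (Suc p) (Suc q) =
          ?t * ?t * RR + (1 - ?t) * (?t + \<tau> ^ (m - 1)) * LR + (1 - ?t) * (1 - \<tau> ^ (m - 1)) * LL"
        using that by (intro IH1) auto
      also have "\<tau> * \<dots> = \<tau> * (?t * ?t * RR + (1 - ?t) * ?t * LR + (1 - ?t) * LL) +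
          ((1 - ?t) * (\<tau> * \<tau> ^ (m - 1))) * (LR - LL)"
        by (simp add: algebra_simps)
      finally show ?thesis unfolding pow by (simp add: algebra_simps)
    qed
    have 2: "cross s a (Suc m) g p q = ?t * LR + (1 - ?t) * LL"
      if "s < p" "p \<le> s + a" "s + a < q" "q \<le> s + a + Suc m"
    proof (cases "q = Suc (s + a)")
      case True
      then show ?thesis using that dep1[of "Suc p"] by (simp add: block_Suc_first row_both_last)
    next
      case False
      with that have "m \<noteq> 0" by auto
      then obtain m' where m: "m = Suc m'" by (cases m) auto
      have "cross s a (Suc m) g p q = \<tau> * cross (Suc s) a m g (Suc p) q + (1 - \<tau>) * LL"
        using that False dep2[of q] block_Suc_first[of True s a m] by (simp add: row_low)
      also have "cross (Suc s) a m g (Suc p) q = \<tau> ^ (m - 1) * LR + (1 - \<tau> ^ (m - 1)) * LL"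
        using that False by (intro IH2) auto
      finally show ?thesis by (simp add: m algebra_simps)
    qed
    have 3: "cross s a (Suc m) g p q = LL" if "s + a < p" "p < q" "q \<le> s + a + Suc m"
    proof (cases "p = Suc (s + a)")
      case True
      then show ?thesis using that dep2[of q] by (simp add: block_Suc_first row_low_last)
    next
      case False
      then show ?thesis using that IH3[of p q] by (simp add: block_Suc_first row_outside)
    qed
    show ?case using 1 2 3 by simp
  qed simp
  then show "s < p \<Longrightarrow> p < q \<Longrightarrow> q \<le> s + a \<Longrightarrow> cross s a m g p q =
      \<tau> ^ m * \<tau> ^ m * RR + (1 - \<tau> ^ m) * (\<tau> ^ m + \<tau> ^ (m - 1)) * LR
      + (1 - \<tau> ^ m) * (1 - \<tau> ^ (m - 1)) * LL"
    and "s < p \<Longrightarrow> p \<le> s + a \<Longrightarrow> s + a < q \<Longrightarrow> q \<le> s + a + m \<Longrightarrow> cross s a m g p q =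
      \<tau> ^ (m - 1) * LR + (1 - \<tau> ^ (m - 1)) * LL"
    and "s + a < p \<Longrightarrow> p < q \<Longrightarrow> q \<le> s + a + m \<Longrightarrow> cross s a m g p q = LL"
    by blast+
qed

end

text \<open>The crossing of two cables of the same width, as an operator on functions of the cables
  \<open>a \<le> b\<close> that contain the two particles. Here \<open>Q = \<tau>\<^sup>m\<close> and \<open>u = \<tau>\<^sup>m\<^sup>-\<^sup>1\<close> for width \<open>m\<close>; that only
  these two quantities enter is what allows \<open>m\<close> to be replaced by an indeterminate.\<close>

definition fused :: "'a::comm_ring_1 \<Rightarrow> 'a \<Rightarrow> nat \<Rightarrow> (nat \<Rightarrow> nat \<Rightarrow> 'a) \<Rightarrow> nat \<Rightarrow> nat \<Rightarrow> 'a" where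
  "fused Q u k g a b =
    (if a = k \<and> b = k then
       Q * Q * g (Suc k) (Suc k) + (1 - Q) * (Q + u) * g k (Suc k) + (1 - Q) * (1 - u) * g k k
     else if a = k \<and> b = Suc k then u * g k (Suc k) + (1 - u) * g k k
     else if a = Suc k \<and> b = Suc k then g k k
     else if a = k then (1 - Q) * g k b + Q * g (Suc k) b
     else if a = Suc k then g k b
     else if b = k then (1 - Q) * g a k + Q * g a (Suc k)
     else if b = Suc k then g a k
     else g a b)"

text \<open>The cable containing position \<open>p\<close>, if all cables have width \<open>c\<close>. Position 0, which is not a
  strand, belongs to cable 0.\<close>

definition cable_of :: "nat \<Rightarrow> nat \<Rightarrow> nat" where
  "cable_of c p = (p + c - 1) div c"

lemma cable_of_eq_iff:
  assumes "c > 0"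
  shows "cable_of c p = Suc k \<longleftrightarrow> k * c < p \<and> p \<le> k * c + c"
proof -
  have "cable_of c p = Suc k \<longleftrightarrow> Suc k * c \<le> p + c - 1 \<and> p + c - 1 < Suc (Suc k) * c"
    unfolding cable_of_def using assms
      less_eq_div_iff_mult_less_eq[of c "Suc k" "p + c - 1"] div_less_iff_less_mult[of c "p + c - 1" "Suc (Suc k)"]
    by linarith
  then show ?thesis using assms by auto
qed

lemma cable_of_le_iff:
  assumes "c > 0"
  shows "cable_of c p \<le> k \<longleftrightarrow> p \<le> k * c"
proof -
  have "cable_of c p < Suc k \<longleftrightarrow> p + c - 1 < Suc k * c"
    unfolding cable_of_def using assms by (simp add: div_less_iff_less_mult)
  then show ?thesis using assms by auto
qed

lemma cross_cable_of:
  assumes c: "c > 0" and k: "k \<ge> 1" and pq: "p < q"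
    and g: "\<And>p q. p < q \<Longrightarrow> G p q = g (cable_of c p) (cable_of c q)"
  shows "hops \<tau> (block True ((k - 1) * c) c c) G p q = fused (\<tau> ^ c) (\<tau> ^ (c - 1)) k g (cable_of c p) (cable_of c q)"
proof -
  define s where "s = (k - 1) * c"
  have kc: "k * c = s + c" "Suc k * c = s + c + c" using k by (cases k; simp add: s_def)+
  have low: "cable_of c x < k \<longleftrightarrow> x \<le> s" for x
    using cable_of_le_iff[OF c, of x "k - 1"] k by (auto simp: s_def)
  have left: "cable_of c x = k \<longleftrightarrow> s < x \<and> x \<le> s + c" for x
    using cable_of_eq_iff[OF c, of x "k - 1"] k by (auto simp: s_def)
  have right: "cable_of c x = Suc k \<longleftrightarrow> s + c < x \<and> x \<le> s + c + c" for x
    using cable_of_eq_iff[OF c, of x k] by (auto simp: kc)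
  have high: "Suc k < cable_of c x \<longleftrightarrow> s + c + c < x" for x
    using cable_of_le_iff[OF c, of x "Suc k"] unfolding kc by auto
  let ?X = "hops \<tau> (block True s c c) G"
  consider "p \<le> s" | "s < p" "p \<le> s + c" | "s + c < p" "p \<le> s + c + c" | "s + c + c < p" by linarith
  then have "?X p q = fused (\<tau> ^ c) (\<tau> ^ (c - 1)) k g (cable_of c p) (cable_of c q)"
  proof cases
    case 1
    then have p: "cable_of c p < k" by (simp add: low)
    consider "q \<le> s" | "s < q" "q \<le> s + c" | "s + c < q" "q \<le> s + c + c" | "s + c + c < q" by linarith
    then show ?thesis
    proof cases
      case 1
      then have "cable_of c q < k" by (simp add: low)
      then show ?thesis using p 1 pq \<open>p \<le> s\<close> by (subst cross_outside) (auto simp: g fused_def)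
    next
      case 2
      then have q: "cable_of c q = k" by (simp add: left)
      have "?X p q = (1 - \<tau> ^ c) * g (cable_of c p) k + \<tau> ^ c * g (cable_of c p) (Suc k)"
        using 2 \<open>p \<le> s\<close> by (intro cross_high) (auto simp: g left[THEN iffD2] right[THEN iffD2])
      then show ?thesis using p q by (simp add: fused_def)
    next
      case 3
      then have q: "cable_of c q = Suc k" by (simp add: right)
      have "?X p q = g (cable_of c p) k"
        using 3 \<open>p \<le> s\<close> by (intro cross_high(2)[where R = "g (cable_of c p) (Suc k)"])
          (auto simp: g left[THEN iffD2] right[THEN iffD2])
      then show ?thesis using p q by (simp add: fused_def)
    next
      case 4
      then have "Suc k < cable_of c q" by (simp add: high)
      then show ?thesis using p 4 pq \<open>p \<le> s\<close> by (subst cross_outside) (auto simp: g fused_def)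
    qed
  next
    case 2
    then have p: "cable_of c p = k" by (simp add: left)
    consider "q \<le> s + c" | "s + c < q" "q \<le> s + c + c" | "s + c + c < q" by linarith
    then show ?thesis
    proof cases
      case 1
      then have q: "cable_of c q = k" using 2 pq by (simp add: left)
      have "?X p q = \<tau> ^ c * \<tau> ^ c * g (Suc k) (Suc k)
          + (1 - \<tau> ^ c) * (\<tau> ^ c + \<tau> ^ (c - 1)) * g k (Suc k)
          + (1 - \<tau> ^ c) * (1 - \<tau> ^ (c - 1)) * g k k"
        using 1 2 pq by (intro cross_both) (auto simp: g left[THEN iffD2] right[THEN iffD2])
      then show ?thesis using p q by (simp add: fused_def)
    next
      case q: 2
      then have qk: "cable_of c q = Suc k" by (simp add: right)
      have "?X p q = \<tau> ^ (c - 1) * g k (Suc k) + (1 - \<tau> ^ (c - 1)) * g k k"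
        using q 2 pq by (intro cross_both(2)[where RR = "g (Suc k) (Suc k)"])
          (auto simp: g left[THEN iffD2] right[THEN iffD2])
      then show ?thesis using p qk by (simp add: fused_def)
    next
      case 3
      then have q: "Suc k < cable_of c q" by (simp add: high)
      have "?X p q = (1 - \<tau> ^ c) * g k (cable_of c q) + \<tau> ^ c * g (Suc k) (cable_of c q)"
        using 2 3 by (intro cross_low) (auto simp: g left[THEN iffD2] right[THEN iffD2])
      then show ?thesis using p q by (simp add: fused_def)
    qed
  next
    case 3
    then have p: "cable_of c p = Suc k" by (simp add: right)
    show ?thesis
    proof (cases "q \<le> s + c + c")
      case True
      then have q: "cable_of c q = Suc k" using 3 pq by (simp add: right)
      have "?X p q = g k k"
        using True 3 pq
        by (intro cross_both(3)[where RR = "g (Suc k) (Suc k)" and LR = "g k (Suc k)"])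
          (auto simp: g left[THEN iffD2] right[THEN iffD2])
      then show ?thesis using p q by (simp add: fused_def)
    next
      case False
      then have q: "Suc k < cable_of c q" by (simp add: high)
      have "?X p q = g k (cable_of c q)"
        using False 3 by (intro cross_low(2)[where R = "g (Suc k) (cable_of c q)"])
          (auto simp: g left[THEN iffD2] right[THEN iffD2])
      then show ?thesis using p q by (simp add: fused_def)
    qed
  next
    case 4
    then have "Suc k < cable_of c p" "Suc k < cable_of c q" using pq by (simp_all add: high)
    then show ?thesis using 4 pq by (subst cross_outside) (auto simp: g fused_def)
  qed
  then show ?thesis by (simp add: s_def)
qed

lemma cable_word_uniform:
  "cable_word (\<lambda>_. m) ((i, b) # w) = block b ((i - 1) * m) m m @ cable_word (\<lambda>_. m) w"
  by (simp add: o_def)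

lemma cable_after_uniform: "cable_after (\<lambda>_. m) w = (\<lambda>_. m)"
  by (induction w) (auto simp: o_def)

lemma cable_word_positive: "\<forall>l\<in>set (cable_word c (positive ks)). snd l"
  by (induction ks arbitrary: c) (auto dest: snd_block simp del: o_apply)

lemma hops_cable:
  assumes "m > 0" "set ks \<subseteq> {1..}" "p < q" "\<And>p q. p < q \<Longrightarrow> G p q = g (cable_of m p) (cable_of m q)"
  shows "hops \<tau> (cable_word (\<lambda>_. m) (positive ks)) G p q =
    foldr (fused (\<tau> ^ m) (\<tau> ^ (m - 1))) ks g (cable_of m p) (cable_of m q)"
  using assms(2,3)
proof (induction ks arbitrary: p q)
  case Nil
  then show ?case using assms(4) by simp
next
  case (Cons k ks)
  then show ?case
    unfolding positive_simps cable_word_uniform hops_simps foldr.simps o_apply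
    using assms(1) by (intro cross_cable_of) auto
qed

section \<open>Two-parameter deformation of the cabled action\<close>

text \<open>The initial vector is chosen so that for \<open>t = 0\<close> it lies in the submodule \<open>balanced\<close> and all its
  Krammer coordinates, defined below, are equal to 1.\<close>

definition start_vec :: "'a::comm_ring_1 \<Rightarrow> nat \<Rightarrow> nat \<Rightarrow> 'a" where
  "start_vec Q a b = (if a < b then Q ^ (a - 1) else - (\<Sum>x\<in>{1..<b}. Q ^ (x - 1)))"

text \<open>The transpose of \<open>fused Q (t * Q) k\<close>.\<close>

definition braid_step :: "'a::comm_ring_1 \<Rightarrow> 'a \<Rightarrow> nat \<Rightarrow> (nat \<Rightarrow> nat \<Rightarrow> 'a) \<Rightarrow> nat \<Rightarrow> nat \<Rightarrow> 'a" where
  "braid_step Q t k v a b =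
    (if a = k \<and> b = k then
       (1 - Q) * (1 - t * Q) * v k k + (1 - t * Q) * v k (Suc k) + v (Suc k) (Suc k)
     else if a = k \<and> b = Suc k then (1 - Q) * (Q + t * Q) * v k k + t * Q * v k (Suc k)
     else if a = Suc k \<and> b = Suc k then Q * Q * v k k
     else if a = k then (1 - Q) * v k b + v (Suc k) b
     else if a = Suc k then Q * v k b
     else if b = k then (1 - Q) * v a k + v a (Suc k)
     else if b = Suc k then Q * v a k
     else v a b)"

definition braid_vec :: "'a::comm_ring_1 \<Rightarrow> 'a \<Rightarrow> nat list \<Rightarrow> nat \<Rightarrow> nat \<Rightarrow> 'a" where
  "braid_vec Q t ks = fold (braid_step Q t) ks (start_vec Q)"

lemma braid_vec_simps: "braid_vec Q t [] = start_vec Q" "braid_vec Q t (ks @ [k]) = braid_step Q t k (braid_vec Q t ks)"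
  by (simp_all add: braid_vec_def)

lemma braid_vec_hom:
  fixes h :: "'a::comm_ring_1 \<Rightarrow> 'b::comm_ring_1"
  assumes add: "\<And>x y. h (x + y) = h x + h y" and mult: "\<And>x y. h (x * y) = h x * h y" and one: "h 1 = 1"
  shows "braid_vec (h Q) (h t) ks a b = h (braid_vec Q t ks a b)"
proof (induction ks arbitrary: a b rule: rev_induct)
  have zero: "h 0 = 0" using add[of 0 0] by simp
  have uminus: "h (- x) = - h x" for x using add[of x "- x"] zero by (simp add: eq_neg_iff_add_eq_0 add.commute)
  have minus: "h (x - y) = h x - h y" for x y using add[of x "- y"] uminus by simp
  have power: "h (x ^ k) = h x ^ k" for x k by (induction k) (simp_all add: one mult)
  have sum: "h (sum f X) = (\<Sum>x\<in>X. h (f x))" for f and X :: "nat set"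
    by (induction X rule: infinite_finite_induct) (simp_all add: zero add)
  {
    case Nil
    show ?case by (simp add: braid_vec_simps start_vec_def power uminus sum)
  next
    case (snoc k ks)
    then show ?case
      by (simp add: braid_vec_simps braid_step_def add mult minus one)
  }
qed

lemma fused_cong_ordered:
  assumes "\<And>a b. a \<le> b \<Longrightarrow> g a b = g' a b" "a \<le> b"
  shows "foldr (fused Q u) ks g a b = foldr (fused Q u) ks g' a b"
  using assms(2)
proof (induction ks arbitrary: a b)
  case (Cons k ks)
  have "fused Q u k h a b = fused Q u k h' a b" if "\<And>a b. a \<le> b \<Longrightarrow> h a b = h' a b" for h h'
    using that Cons.prems by (simp add: fused_def)
  from this[OF Cons.IH] show ?case by simp
qed (simp add: assms(1))

lemma fused_linear:
  "foldr (fused Q u) ks (\<lambda>a b. g a b + h a b) = (\<lambda>a b. foldr (fused Q u) ks g a b + foldr (fused Q u) ks h a b)"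
  "foldr (fused Q u) ks (\<lambda>a b. c * g a b) = (\<lambda>a b. c * foldr (fused Q u) ks g a b)"
  by (induction ks) (auto simp: fused_def fun_eq_iff algebra_simps)

definition delta :: "nat \<Rightarrow> nat \<Rightarrow> nat \<Rightarrow> nat \<Rightarrow> 'a::comm_ring_1" where
  "delta a b x y = (if x = a \<and> y = b then 1 else 0)"

lemma fused_delta:
  assumes "a \<le> b" "x \<le> y"
  shows "fused Q (t * Q) k (delta a b) x y = braid_step Q t k (\<lambda>a b. delta a b x y) a b"
  using assms by (simp add: fused_def braid_step_def delta_def)

text \<open>The start vector is transported along a word by letting the word act on indicator functions.\<close>

definition pairing :: "nat \<Rightarrow> 'a::comm_ring_1 \<Rightarrow> 'a \<Rightarrow> nat list \<Rightarrow> (nat \<Rightarrow> nat \<Rightarrow> 'a) \<Rightarrow> 'a" where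
  "pairing n Q t ks g =
    (\<Sum>(x, y)\<in>{(x, y). 1 \<le> x \<and> x \<le> y \<and> y \<le> n}. start_vec Q x y * foldr (fused Q (t * Q)) ks g x y)"

lemma pairing_linear:
  "pairing n Q t ks (\<lambda>x y. g x y + h x y) = pairing n Q t ks g + pairing n Q t ks h"
  "pairing n Q t ks (\<lambda>x y. c * g x y) = c * pairing n Q t ks g"
  by (simp_all add: pairing_def fused_linear case_prod_unfold algebra_simps sum.distrib sum_distrib_left)

lemma pairing_delta:
  assumes "set ks \<subseteq> {1..<n}" "1 \<le> a" "a \<le> b" "b \<le> n"
  shows "pairing n Q t ks (delta a b) = braid_vec Q t ks a b"
  using assms
proof (induction ks arbitrary: a b rule: rev_induct)
  case Nil
  let ?P = "{(x, y). 1 \<le> x \<and> x \<le> y \<and> y \<le> n}"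
  have fin: "finite ?P"
    by (rule finite_subset[of _ "{1..n} \<times> {1..n}"]) auto
  have "pairing n Q t [] (delta a b) = (\<Sum>z\<in>?P. if z = (a, b) then start_vec Q a b else 0)"
    unfolding pairing_def by (intro sum.cong) (auto simp: delta_def split: if_splits)
  also have "\<dots> = start_vec Q a b" using Nil fin by (subst sum.delta) auto
  finally show ?case by (simp add: braid_vec_simps)
next
  case (snoc k ks)
  have "foldr (fused Q (t * Q)) (ks @ [k]) (delta a b) x y =
      foldr (fused Q (t * Q)) ks (\<lambda>x y. braid_step Q t k (\<lambda>a b. delta a b x y) a b) x y" if "x \<le> y" for x y
    using that by (simp add: fused_cong_ordered[OF fused_delta[OF snoc.prems(3)]])
  then have "pairing n Q t (ks @ [k]) (delta a b) =
      pairing n Q t ks (\<lambda>x y. braid_step Q t k (\<lambda>a b. delta a b x y) a b)"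
    unfolding pairing_def by (intro sum.cong) auto
  also have "\<dots> = braid_step Q t k (\<lambda>a b. pairing n Q t ks (delta a b)) a b"
    by (auto simp: braid_step_def pairing_linear)
  also have "\<dots> = braid_step Q t k (braid_vec Q t ks) a b"
    using snoc.prems by (simp add: braid_step_def snoc.IH)
  finally show ?case by (simp add: braid_vec_simps)
qed

text \<open>The entries of \<open>braid_vec\<close> with \<open>a = b\<close> belong to two particles in the same cable, which takes width
  at least 2.\<close>

lemma jones_cable_eq_imp_braid_vec_eq:
  assumes m: "m \<ge> 2" and ks: "set ks \<subseteq> {1..<n}" and ls: "set ls \<subseteq> {1..<n}"
    and eq: "jones_word (n * m) (cable_word (\<lambda>_. m) (positive ks)) =
      jones_word (n * m) (cable_word (\<lambda>_. m) (positive ls))"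
    and ab: "1 \<le> a" "a \<le> b" "b \<le> n"
  shows "braid_vec (inverse A_var ^ (4 * m)) (A_var ^ 4) ks a b = braid_vec (inverse A_var ^ (4 * m)) (A_var ^ 4) ls a b"
proof -
  let ?\<tau> = "inverse A_var ^ 4" and ?t = "A_var ^ 4"
  let ?Q = "?\<tau> ^ m"
  have u: "?\<tau> ^ (m - 1) = ?t * ?Q"
    using m A_var_nonzero by (cases m) (simp_all add: field_simps)
  have words: "cable_word (\<lambda>_. m) (positive js) \<in> braid_words (n * m)" if "set js \<subseteq> {1..<n}" for js
    using cable_word_words[of "positive js" n "\<lambda>_. m"] that by simp
  have hops: "hops ?\<tau> (cable_word (\<lambda>_. m) (positive ks)) = hops ?\<tau> (cable_word (\<lambda>_. m) (positive ls))"
    using words[OF ks] words[OF ls] cable_word_positive cable_word_positive eq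
    by (rule jones_word_eq_imp_hops_eq)
  have "foldr (fused ?Q (?t * ?Q)) ks g x y = foldr (fused ?Q (?t * ?Q)) ls g x y"
    if xy: "1 \<le> x" "x \<le> y" for g x y
  proof -
    define p where "p = (x - 1) * m + 1"
    define q where "q = (y - 1) * m + 2"
    have "(x - 1) * m \<le> (y - 1) * m" using xy by (intro mult_right_mono) auto
    then have pq: "p < q" unfolding p_def q_def by linarith
    have cable_of: "cable_of m p = x" "cable_of m q = y"
      using xy m cable_of_eq_iff[of m p "x - 1"] cable_of_eq_iff[of m q "y - 1"] by (auto simp: p_def q_def)
    have "hops ?\<tau> (cable_word (\<lambda>_. m) (positive js)) (\<lambda>p q. g (cable_of m p) (cable_of m q)) p q =
        foldr (fused ?Q (?t * ?Q)) js g x y" if "set js \<subseteq> {1..<n}" for js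
    proof -
      have "set js \<subseteq> {1..}" using that by auto
      then show ?thesis
        using hops_cable[of m js p q "\<lambda>p q. g (cable_of m p) (cable_of m q)" g ?\<tau>] m pq
        unfolding u cable_of by simp
    qed
    from this[OF ks] this[OF ls] show ?thesis by (simp add: hops)
  qed
  then have "pairing n ?Q ?t ks (delta a b) = pairing n ?Q ?t ls (delta a b)"
    unfolding pairing_def by (intro sum.cong) auto
  then show ?thesis
    using ab by (simp add: pairing_delta[OF ks] pairing_delta[OF ls] power_mult)
qed

lemma A_var_power_inj: "A_var ^ j = A_var ^ k \<Longrightarrow> j = k"
proof -
  have "A_var ^ k = Fract (monom 1 k) 1" for k
    by (induction k) (simp_all add: A_var_def One_fract_def one_pCons monom_Suc monom_0)
  then show "A_var ^ j = A_var ^ k \<Longrightarrow> j = k"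
    by (simp add: eq_fract monom_eq_iff')
qed

text \<open>The entries are polynomials in \<open>Q\<close> and \<open>t\<close>. For \<open>t = A\<^sup>4\<close> they agree at the infinitely many points
  \<open>Q = A\<^sup>-\<^sup>4\<^sup>m\<close>, hence for every \<open>Q\<close>; for \<open>Q = 1/2\<close> they then agree as polynomials in \<open>A\<close>, and \<open>A\<close> can be
  specialised to 0.\<close>

lemma braid_vec_eq_specialised:
  assumes "\<And>m. m \<ge> 2 \<Longrightarrow> braid_vec (inverse A_var ^ (4 * m)) (A_var ^ 4) ks a b =
      braid_vec (inverse A_var ^ (4 * m)) (A_var ^ 4) ls a b"
  shows "braid_vec (1/2 :: real) 0 ks a b = braid_vec (1/2) 0 ls a b"
proof -
  let ?F = "\<lambda>js. braid_vec [:0, 1:] [:A_var ^ 4:] js a b"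
  have F: "poly (?F js) q = braid_vec q (A_var ^ 4) js a b" for js q
    using braid_vec_hom[of "\<lambda>p. poly p q" "[:0, 1:]" "[:A_var ^ 4:]" js a b] by simp
  have "inj (\<lambda>m. inverse A_var ^ (4 * m))"
    by (rule injI) (auto simp: power_inverse dest: A_var_power_inj)
  then have "infinite ((\<lambda>m. inverse A_var ^ (4 * m)) ` {2..})"
    by (auto dest!: finite_imageD intro: inj_on_subset simp: infinite_Ici)
  moreover have "(\<lambda>m. inverse A_var ^ (4 * m)) ` {2..} \<subseteq> {q. poly (?F ks - ?F ls) q = 0}"
    using assms by (auto simp: F)
  ultimately have "?F ks - ?F ls = 0"
    using poly_roots_finite finite_subset by blast
  then have "?F ks = ?F ls" by simp
  then have generic: "braid_vec q (A_var ^ 4) ks a b = braid_vec q (A_var ^ 4) ls a b" for q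
    using F[of ks q] F[of ls q] by simp
  let ?G = "\<lambda>js. braid_vec [:1/2:] ([:0, 1:] ^ 4) js a b :: complex poly"
  have G: "Fract (?G js) 1 = braid_vec (Fract [:1/2:] 1) (A_var ^ 4) js a b" for js
    using braid_vec_hom[of "\<lambda>p. Fract p 1" "[:1/2:]" "[:0, 1:] ^ 4 :: complex poly" js a b]
    by (simp add: One_fract_def A_var_def power4_eq_xxxx)
  have "Fract (?G ks) 1 = Fract (?G ls) 1"
    unfolding G by (rule generic)
  then have "?G ks = ?G ls" by (simp add: eq_fract)
  moreover have "poly (?G js) 0 = braid_vec (1/2) 0 js a b" for js
    using braid_vec_hom[of "\<lambda>p. poly p 0" "[:1/2:]" "[:0, 1:] ^ 4 :: complex poly" js a b] by simp
  ultimately have "braid_vec (1/2 :: complex) 0 ks a b = braid_vec (1/2) 0 ls a b"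
    by metis
  moreover have "braid_vec (1/2) 0 js a b = complex_of_real (braid_vec (1/2) 0 js a b)" for js
    using braid_vec_hom[of complex_of_real "1/2" 0 js a b] by simp
  ultimately show ?thesis by simp
qed

section \<open>Krammer coordinates\<close>

text \<open>Removing one of the two particles intertwines the braid action on two particles with the one on a
  single particle. The kernel of this map is the Lawrence-Krammer representation. For \<open>t = 0\<close> the
  map is \<open>v \<mapsto> (\<lambda>b. \<Sum>a\<le>b. v a b)\<close>, so the kernel consists of the balanced vectors.
  The coordinates below, for \<open>a < b\<close>, are those in which the generators act by matrices with
  nonnegative entries for \<open>0 \<le> Q \<le> 1\<close>.\<close>

definition krammer_coord :: "'a::comm_ring_1 \<Rightarrow> (nat \<Rightarrow> nat \<Rightarrow> 'a) \<Rightarrow> nat \<Rightarrow> nat \<Rightarrow> 'a" where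
  "krammer_coord Q v a b = v a b + (1 - Q) * (\<Sum>x\<in>{1..<a}. v x b)"

definition balanced :: "(nat \<Rightarrow> nat \<Rightarrow> 'a::comm_ring_1) \<Rightarrow> bool" where
  "balanced v \<longleftrightarrow> (\<forall>b\<ge>1. (\<Sum>x\<in>{1..<b}. v x b) + v b b = 0)"

lemma sum_split_pair:
  fixes f :: "nat \<Rightarrow> 'a::comm_ring_1"
  assumes "1 \<le> k" "Suc k < a"
  shows "sum f {1..<a} = sum f {1..<k} + f k + f (Suc k) + sum f {Suc (Suc k)..<a}"
proof -
  have "sum f {1..<a} = sum f {1..<Suc (Suc k)} + sum f {Suc (Suc k)..<a}"
    using assms by (intro sum.atLeastLessThan_concat[symmetric]) auto
  then show ?thesis using assms by simp
qed

lemma sum_step_column: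
  assumes "1 \<le> k" "Suc k < a" "a \<le> b"
  shows "(\<Sum>x\<in>{1..<a}. braid_step Q t k v x b) = (\<Sum>x\<in>{1..<a}. v x b)"
proof -
  have "(\<Sum>x\<in>{1..<k}. braid_step Q t k v x b) = (\<Sum>x\<in>{1..<k}. v x b)"
    "(\<Sum>x\<in>{Suc (Suc k)..<a}. braid_step Q t k v x b) = (\<Sum>x\<in>{Suc (Suc k)..<a}. v x b)"
    using assms by (intro sum.cong; auto simp: braid_step_def)+
  moreover have "braid_step Q t k v k b = (1 - Q) * v k b + v (Suc k) b" "braid_step Q t k v (Suc k) b = Q * v k b"
    using assms by (auto simp: braid_step_def)
  ultimately show ?thesis
    unfolding sum_split_pair[OF assms(1,2)] by (simp add: algebra_simps)
qed

lemma sum_step_below: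
  assumes "a \<le> k"
  shows "(\<Sum>x\<in>{1..<a}. braid_step Q t k v x k) = (1 - Q) * (\<Sum>x\<in>{1..<a}. v x k) + (\<Sum>x\<in>{1..<a}. v x (Suc k))"
    and "(\<Sum>x\<in>{1..<a}. braid_step Q t k v x (Suc k)) = Q * (\<Sum>x\<in>{1..<a}. v x k)"
    and "b \<noteq> k \<Longrightarrow> b \<noteq> Suc k \<Longrightarrow> (\<Sum>x\<in>{1..<a}. braid_step Q t k v x b) = (\<Sum>x\<in>{1..<a}. v x b)"
proof -
  have "braid_step Q t k v x k = (1 - Q) * v x k + v x (Suc k)" if "x < a" for x
    using that assms by (auto simp: braid_step_def)
  then show "(\<Sum>x\<in>{1..<a}. braid_step Q t k v x k) = (1 - Q) * (\<Sum>x\<in>{1..<a}. v x k) + (\<Sum>x\<in>{1..<a}. v x (Suc k))"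
    by (simp add: sum.distrib sum_distrib_left)
  have "braid_step Q t k v x (Suc k) = Q * v x k" if "x < a" for x
    using that assms by (auto simp: braid_step_def)
  then show "(\<Sum>x\<in>{1..<a}. braid_step Q t k v x (Suc k)) = Q * (\<Sum>x\<in>{1..<a}. v x k)"
    by (simp add: sum_distrib_left)
  show "(\<Sum>x\<in>{1..<a}. braid_step Q t k v x b) = (\<Sum>x\<in>{1..<a}. v x b)" if "b \<noteq> k" "b \<noteq> Suc k"
    using that assms by (intro sum.cong) (auto simp: braid_step_def)
qed

lemma balanced_step:
  assumes "1 \<le> k" "balanced v"
  shows "balanced (braid_step Q 0 k v)"
  unfolding balanced_def
proof (intro allI impI)
  fix b :: nat assume b: "1 \<le> b"
  have bal: "v b b = - (\<Sum>x\<in>{1..<b}. v x b)" if "1 \<le> b" for b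
    using assms(2) that unfolding balanced_def by (simp add: add_eq_0_iff)
  consider "b < k" | "b = k" | "b = Suc k" | "Suc k < b" by linarith
  then show "(\<Sum>x\<in>{1..<b}. braid_step Q 0 k v x b) + braid_step Q 0 k v b b = 0"
  proof cases
    case 1
    then show ?thesis using sum_step_below(3)[of b k b Q 0 v] bal[OF b]
      by (simp add: braid_step_def)
  next
    case 2
    then show ?thesis using sum_step_below(1)[of k k Q 0 v] bal[of k] bal[of "Suc k"] assms(1)
      by (simp add: braid_step_def algebra_simps)
  next
    case 3
    have "braid_step Q 0 k v k (Suc k) = (1 - Q) * Q * v k k" "braid_step Q 0 k v (Suc k) (Suc k) = Q * Q * v k k"
      by (simp_all add: braid_step_def)
    then show ?thesis using 3 sum_step_below(2)[of k k Q 0 v] bal[of k] assms(1)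
      by (simp add: algebra_simps)
  next
    case 4
    then show ?thesis using sum_step_column[of k b b Q 0 v] bal[of b] assms(1)
      by (simp add: braid_step_def)
  qed
qed

text \<open>These are Krammer's formulas for \<open>t = 0\<close>. The coordinate \<open>(k, k + 1)\<close> is annihilated by \<open>\<sigma>\<^sub>k\<close>, which
  is how right divisibility by \<open>\<sigma>\<^sub>k\<close> leaves a trace.\<close>

lemma krammer_coord_step:
  assumes "1 \<le> k" "a < b" "balanced v"
  shows "krammer_coord Q (braid_step Q 0 k v) a b =
    (if a = k \<and> b = Suc k then 0
     else if a = k then krammer_coord Q v (Suc k) b
     else if a = Suc k then Q * krammer_coord Q v k b + (1 - Q) * krammer_coord Q v (Suc k) b
     else if b = k then (1 - Q) * krammer_coord Q v a k + krammer_coord Q v a (Suc k)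
     else if b = Suc k then Q * krammer_coord Q v a k
     else krammer_coord Q v a b)"
proof -
  consider "a = k" "b = Suc k" | "a = k" "b \<noteq> Suc k" | "a = Suc k" | "a < k" "b = k"
    | "a < k" "b = Suc k" | "a < k" "b \<noteq> k" "b \<noteq> Suc k" | "Suc k < a"
    by linarith
  then show ?thesis
  proof cases
    case 1
    have "v k k = - (\<Sum>x\<in>{1..<k}. v x k)"
      using assms unfolding balanced_def by (simp add: add_eq_0_iff)
    moreover have "braid_step Q 0 k v k (Suc k) = (1 - Q) * Q * v k k" by (simp add: braid_step_def)
    ultimately show ?thesis
      using 1 sum_step_below(2)[of k k Q 0 v] by (simp add: krammer_coord_def algebra_simps)
  next
    case 2
    then have "braid_step Q 0 k v k b = (1 - Q) * v k b + v (Suc k) b"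
      using assms by (simp add: braid_step_def)
    then show ?thesis
      using 2 assms sum_step_below(3)[of k k b Q 0 v] by (simp add: krammer_coord_def) (simp add: algebra_simps)
  next
    case 3
    then have "braid_step Q 0 k v k b = (1 - Q) * v k b + v (Suc k) b" "braid_step Q 0 k v (Suc k) b = Q * v k b"
      using assms by (simp_all add: braid_step_def)
    then show ?thesis
      using 3 assms sum_step_below(3)[of k k b Q 0 v]
      by (simp add: krammer_coord_def) (simp add: algebra_simps)
  next
    case 4
    then have "braid_step Q 0 k v a k = (1 - Q) * v a k + v a (Suc k)"
      by (simp add: braid_step_def)
    then show ?thesis
      using 4 sum_step_below(1)[of a k Q 0 v] by (simp add: krammer_coord_def) (simp add: algebra_simps)
  next
    case 5
    then have "braid_step Q 0 k v a (Suc k) = Q * v a k"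
      by (simp add: braid_step_def)
    then show ?thesis
      using 5 sum_step_below(2)[of a k Q 0 v] by (simp add: krammer_coord_def) (simp add: algebra_simps)
  next
    case 6
    then have "braid_step Q 0 k v a b = v a b"
      by (simp add: braid_step_def)
    then show ?thesis
      using 6 sum_step_below(3)[of a k b Q 0 v] by (simp add: krammer_coord_def)
  next
    case 7
    then have "braid_step Q 0 k v a b = v a b"
      using assms by (simp add: braid_step_def)
    then show ?thesis
      using 7 assms sum_step_column[of k a b Q 0 v] by (simp add: krammer_coord_def)
  qed
qed

text \<open>Any value of \<open>Q\<close> strictly between 0 and 1 would serve: then a sum of nonnegative coordinates with
  the coefficients \<open>Q\<close> and \<open>1 - Q\<close> vanishes only if each of them vanishes.\<close>

definition krammer :: "nat list \<Rightarrow> nat \<Rightarrow> nat \<Rightarrow> real" where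
  "krammer ks = krammer_coord (1/2) (braid_vec (1/2) 0 ks)"

lemma krammer_Nil:
  assumes "1 \<le> a" "a < b"
  shows "krammer [] a b = 1"
proof -
  have geometric: "(1 - Q) * (\<Sum>x\<in>{1..<a}. Q ^ (x - 1)) = 1 - Q ^ (a - 1)" for Q :: real
    using assms(1)
  proof (induction a rule: dec_induct)
    case (step a)
    then have "Q ^ a = Q * Q ^ (a - 1)" by (cases a) auto
    with step show ?case by (simp add: distrib_left) (simp add: algebra_simps)
  qed simp
  have "(\<Sum>x\<in>{1..<a}. braid_vec (1/2) 0 [] x b) = (\<Sum>x\<in>{1..<a}. (1/2 :: real) ^ (x - 1))"
    using assms by (intro sum.cong) (auto simp: braid_vec_simps start_vec_def)
  then show ?thesis
    using assms geometric[of "1/2"]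
    by (simp add: krammer_def krammer_coord_def) (simp add: braid_vec_simps start_vec_def field_simps)
qed

lemma balanced_braid_vec:
  assumes "set ks \<subseteq> {1..}"
  shows "balanced (braid_vec Q 0 ks)"
  using assms
proof (induction ks rule: rev_induct)
  case Nil
  show ?case by (simp add: balanced_def braid_vec_simps start_vec_def)
next
  case (snoc k ks)
  then show ?case by (auto simp: braid_vec_simps intro: balanced_step)
qed

lemma krammer_snoc:
  assumes "set ks \<subseteq> {1..}" "1 \<le> k" "a < b"
  shows "krammer (ks @ [k]) a b =
    (if a = k \<and> b = Suc k then 0
     else if a = k then krammer ks (Suc k) b
     else if a = Suc k then (krammer ks k b + krammer ks (Suc k) b) / 2
     else if b = k then krammer ks a k / 2 + krammer ks a (Suc k)
     else if b = Suc k then krammer ks a k / 2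
     else krammer ks a b)"
  unfolding krammer_def braid_vec_simps krammer_coord_step[OF assms(2,3) balanced_braid_vec[OF assms(1)]]
  by (simp add: field_simps)

lemma krammer_nonneg:
  assumes "set ks \<subseteq> {1..}" "1 \<le> a" "a < b"
  shows "0 \<le> krammer ks a b"
  using assms
proof (induction ks arbitrary: a b rule: rev_induct)
  case Nil
  then show ?case by (simp add: krammer_Nil)
next
  case (snoc k ks)
  then show ?case by (auto simp: krammer_snoc)
qed

section \<open>Faithfulness on positive braids\<close>

text \<open>Cablings with all cables of the same width \<open>m\<close> suffice.\<close>

definition same_jones :: "nat \<Rightarrow> nat list \<Rightarrow> nat list \<Rightarrow> bool" where
  "same_jones n ks ls \<longleftrightarrow> (\<forall>m\<ge>2. jones_word (n * m) (cable_word (\<lambda>_. m) (positive ks)) =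
    jones_word (n * m) (cable_word (\<lambda>_. m) (positive ls)))"

lemma jones_word_cable_cong:
  assumes "braid_eq n u v"
  shows "jones_word (n * m) (cable_word (\<lambda>_. m) u) = jones_word (n * m) (cable_word (\<lambda>_. m) v)"
  using cable_word_cong[OF assms, of "\<lambda>_. m"] by (intro jones_word_cong) simp

lemma uniform_cable_words:
  "w \<in> braid_words n \<Longrightarrow> cable_word (\<lambda>_. m) w \<in> braid_words (n * m)"
  using cable_word_words[of w n "\<lambda>_. m"] by simp

lemma uniform_cable_append:
  "cable_word (\<lambda>_. m) (u @ v) = cable_word (\<lambda>_. m) u @ cable_word (\<lambda>_. m) v"
  by (simp add: cable_word_append cable_after_uniform)

lemma same_jones_trans: "same_jones n ks ls \<Longrightarrow> same_jones n ls js \<Longrightarrow> same_jones n ks js"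
  and same_jones_sym: "same_jones n ks ls \<Longrightarrow> same_jones n ls ks"
  by (simp_all add: same_jones_def)

lemma braid_eq_imp_same_jones: "braid_eq n (positive ks) (positive ls) \<Longrightarrow> same_jones n ks ls"
  by (simp add: same_jones_def jones_word_cable_cong)

lemma same_jones_cancel:
  assumes "same_jones n (ks @ [k]) (ls @ [k])" "set ks \<subseteq> {1..<n}" "set ls \<subseteq> {1..<n}" "k \<in> {1..<n}"
  shows "same_jones n ks ls"
  unfolding same_jones_def
proof (intro allI impI)
  fix m :: nat assume "2 \<le> m"
  let ?J = "\<lambda>w. jones_word (n * m) (cable_word (\<lambda>_. m) w)"
  have "?J (positive js) = ?J (positive (js @ [k])) \<otimes>\<^bsub>TL (n * m)\<^esub> ?J [(k, False)]"
    if js: "set js \<subseteq> {1..<n}" for js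
  proof -
    have "braid_eq n (positive js @ [(k, True), (k, False)]) (positive js @ [])"
      using js assms(4) braid_eq.cancel[of k n True] by (intro braid_eq.append braid_eq.refl) auto
    then have "?J (positive js) = ?J (positive (js @ [k]) @ [(k, False)])"
      using jones_word_cable_cong[of n _ _ m] by fastforce
    also have "\<dots> = ?J (positive (js @ [k])) \<otimes>\<^bsub>TL (n * m)\<^esub> ?J [(k, False)]"
      unfolding uniform_cable_append[of m _ "[(k, False)]"]
      using js assms(4) by (intro jones_word_append uniform_cable_words) auto
    finally show ?thesis .
  qed
  from this[OF assms(2)] this[OF assms(3)] show "?J (positive ks) = ?J (positive ls)"
    using assms(1) \<open>2 \<le> m\<close> by (simp only: same_jones_def)
qed

lemma same_jones_imp_krammer_eq:
  assumes "same_jones n ks ls" "set ks \<subseteq> {1..<n}" "set ls \<subseteq> {1..<n}" "1 \<le> a" "a < b" "b \<le> n"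
  shows "krammer ks a b = krammer ls a b"
proof -
  have "braid_vec (1/2) 0 ks x b = braid_vec (1/2 :: real) 0 ls x b" if "1 \<le> x" "x \<le> b" for x
    using assms that
    by (intro braid_vec_eq_specialised jones_cable_eq_imp_braid_vec_eq[of _ ks n ls]) (auto simp: same_jones_def)
  then show ?thesis
    using assms by (simp add: krammer_def krammer_coord_def)
qed

text \<open>If the last letter \<open>j\<close> is not \<open>k\<close>, the coordinate \<open>(k, k + 1)\<close> of \<open>ks\<close> is a positive combination of
  coordinates of the shorter word, one of which is again \<open>(k, k + 1)\<close>. By induction that word ends
  in \<open>\<sigma>\<^sub>k\<close>, up to braid equivalence. For far \<open>j\<close> the two letters commute. For adjacent \<open>j\<close> there is a second
  vanishing coordinate, which shows that the word with \<open>\<sigma>\<^sub>k\<close> removed ends in \<open>\<sigma>\<^sub>j\<close>; the word then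
  ends in \<open>\<sigma>\<^sub>j \<sigma>\<^sub>k \<sigma>\<^sub>j = \<sigma>\<^sub>k \<sigma>\<^sub>j \<sigma>\<^sub>k\<close>.\<close>

lemma krammer_zero_divisible:
  assumes "set ks \<subseteq> {1..<n}" "k \<in> {1..<n}" "krammer ks k (Suc k) = 0"
  shows "\<exists>ls. set ls \<subseteq> {1..<n} \<and> length ks = Suc (length ls) \<and>
    braid_eq n (positive ks) (positive (ls @ [k]))"
  using assms
proof (induction "length ks" arbitrary: ks k rule: less_induct)
  case less
  have "ks \<noteq> []" using less.prems krammer_Nil[of k "Suc k"] by auto
  then obtain js j where ks: "ks = js @ [j]" by (cases ks rule: rev_cases) auto
  have js: "set js \<subseteq> {1..<n}" and j: "j \<in> {1..<n}" using less.prems ks by auto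
  have nonneg: "krammer js a b \<ge> 0" if "1 \<le> a" "a < b" for a b
    using js that by (intro krammer_nonneg) auto
  have zero: "krammer (js @ [j]) k (Suc k) = 0" using less.prems ks by simp
  have pos: "set js \<subseteq> {1..}" "1 \<le> j" "1 \<le> k" using js j less.prems by auto
  have divide: "\<exists>ls. set ls \<subseteq> {1..<n} \<and> length js = Suc (length ls) \<and>
      braid_eq n (positive js) (positive (ls @ [k]))" if "krammer js k (Suc k) = 0"
    using less.hyps[of js k] js less.prems(2) that by (simp add: ks)
  consider "j = k" | "j = Suc k" | "k = Suc j" | "j + 2 \<le> k \<or> k + 2 \<le> j" by linarith
  then show ?case
  proof cases
    case 1
    then show ?thesis using less.prems(1) js by (auto simp: ks intro!: exI[of _ js] braid_eq.refl)
  next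
    case 2
    have z: "krammer js k (Suc k) = 0" "krammer js k (Suc (Suc k)) = 0"
      using zero 2 nonneg[of k "Suc k"] nonneg[of k "Suc (Suc k)"] pos
      by (simp_all add: krammer_snoc add_nonneg_eq_0_iff)
    obtain ls where ls: "set ls \<subseteq> {1..<n}" "length js = Suc (length ls)"
      "braid_eq n (positive js) (positive (ls @ [k]))" using divide z by blast
    have "krammer (ls @ [k]) k (Suc (Suc k)) = 0"
      using same_jones_imp_krammer_eq[OF braid_eq_imp_same_jones[OF ls(3)] js, of k "Suc (Suc k)"]
        ls(1) less.prems(2) j 2 z by auto
    moreover have "set ls \<subseteq> {1..}" using ls(1) by auto
    ultimately have "krammer ls j (Suc j) = 0" using pos 2 by (simp add: krammer_snoc)
    then obtain ms where ms: "set ms \<subseteq> {1..<n}" "length ls = Suc (length ms)"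
      "braid_eq n (positive ls) (positive (ms @ [j]))"
      using less.hyps[of ls j] ls j by (auto simp: ks)
    have 3: "braid_eq n (positive js @ [(j, True)]) ((positive ls @ [(k, True)]) @ [(j, True)])"
      using ls(3) j by (intro braid_eq.append braid_eq.refl) auto
    have 4: "braid_eq n (positive ls @ [(k, True), (j, True)])
        ((positive ms @ [(j, True)]) @ [(k, True), (j, True)])"
      using ms(3) j less.prems(2) by (intro braid_eq.append braid_eq.refl) auto
    have 5: "braid_eq n (positive ms @ [(j, True), (k, True), (j, True)])
        (positive ms @ [(k, True), (j, True), (k, True)])"
      using ms(1) braid_eq.sym[OF braid_eq.braid[of k n]] j less.prems(2) 2
      by (intro braid_eq.append braid_eq.refl) auto
    have "braid_eq n (positive ks) (positive ((ms @ [k, j]) @ [k]))"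
      using braid_eq.trans[OF 3[unfolded append_assoc append_Cons append_Nil]
        braid_eq.trans[OF 4[unfolded append_assoc append_Cons append_Nil] 5]] by (simp add: ks)
    then show ?thesis using ms ls j less.prems(2) by (intro exI[of _ "ms @ [k, j]"]) (auto simp: ks)
  next
    case 3
    have z: "krammer js k (Suc k) = 0" "krammer js j (Suc k) = 0"
      using zero 3 nonneg[of k "Suc k"] nonneg[of j "Suc k"] pos
      by (simp_all add: krammer_snoc add_nonneg_eq_0_iff)
    obtain ls where ls: "set ls \<subseteq> {1..<n}" "length js = Suc (length ls)"
      "braid_eq n (positive js) (positive (ls @ [k]))" using divide z by blast
    have "krammer (ls @ [k]) j (Suc k) = 0"
      using same_jones_imp_krammer_eq[OF braid_eq_imp_same_jones[OF ls(3)] js, of j "Suc k"]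
        ls(1) less.prems(2) j 3 z by auto
    moreover have "set ls \<subseteq> {1..}" using ls(1) by auto
    ultimately have "krammer ls j (Suc j) = 0" using pos 3 by (simp add: krammer_snoc)
    then obtain ms where ms: "set ms \<subseteq> {1..<n}" "length ls = Suc (length ms)"
      "braid_eq n (positive ls) (positive (ms @ [j]))"
      using less.hyps[of ls j] ls j by (auto simp: ks)
    have 4: "braid_eq n (positive js @ [(j, True)]) ((positive ls @ [(k, True)]) @ [(j, True)])"
      using ls(3) j by (intro braid_eq.append braid_eq.refl) auto
    have 5: "braid_eq n (positive ls @ [(k, True), (j, True)])
        ((positive ms @ [(j, True)]) @ [(k, True), (j, True)])"
      using ms(3) j less.prems(2) by (intro braid_eq.append braid_eq.refl) auto
    have 6: "braid_eq n (positive ms @ [(j, True), (k, True), (j, True)])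
        (positive ms @ [(k, True), (j, True), (k, True)])"
      using ms(1) braid_eq.braid[of j n] j less.prems(2) 3
      by (intro braid_eq.append braid_eq.refl) auto
    have "braid_eq n (positive ks) (positive ((ms @ [k, j]) @ [k]))"
      using braid_eq.trans[OF 4[unfolded append_assoc append_Cons append_Nil]
        braid_eq.trans[OF 5[unfolded append_assoc append_Cons append_Nil] 6]] by (simp add: ks)
    then show ?thesis using ms ls j less.prems(2) by (intro exI[of _ "ms @ [k, j]"]) (auto simp: ks)
  next
    case 4
    then have "krammer js k (Suc k) = 0" using zero pos by (simp add: krammer_snoc split: if_splits)
    then obtain ls where ls: "set ls \<subseteq> {1..<n}" "length js = Suc (length ls)"
      "braid_eq n (positive js) (positive (ls @ [k]))" using divide by blast
    have 5: "braid_eq n (positive js @ [(j, True)]) ((positive ls @ [(k, True)]) @ [(j, True)])"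
      using ls(3) j by (intro braid_eq.append braid_eq.refl) auto
    have 6: "braid_eq n (positive ls @ [(k, True), (j, True)]) (positive ls @ [(j, True), (k, True)])"
      using ls(1) 4 j less.prems(2) by (intro braid_eq.append braid_eq.refl far_letters) auto
    have "braid_eq n (positive ks) (positive ((ls @ [j]) @ [k]))"
      using braid_eq.trans[OF 5[unfolded append_assoc append_Cons append_Nil] 6] by (simp add: ks)
    then show ?thesis using ls j by (intro exI[of _ "ls @ [j]"]) (auto simp: ks)
  qed
qed

lemma krammer_last_zero:
  assumes "set ks \<subseteq> {1..<n}" "k \<in> {1..<n}"
  shows "krammer (ks @ [k]) k (Suc k) = 0"
proof -
  have "set ks \<subseteq> {1..}" using assms by auto
  then show ?thesis using assms by (simp add: krammer_snoc)
qed

text \<open>The last letter of one word can be read off from the coordinates, so it right divides the other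
  word as well. It can be cancelled because the Jones image of a cabled generator is a unit.\<close>

lemma same_jones_imp_braid_eq:
  assumes "same_jones n ks ls" "set ks \<subseteq> {1..<n}" "set ls \<subseteq> {1..<n}"
  shows "braid_eq n (positive ks) (positive ls)"
  using assms
proof (induction ks arbitrary: ls rule: rev_induct)
  case Nil
  have "ls = []"
  proof (rule ccontr)
    assume "ls \<noteq> []"
    then obtain js j where ls: "ls = js @ [j]" by (cases ls rule: rev_cases) auto
    then have j: "j \<in> {1..<n}" "set js \<subseteq> {1..<n}" using Nil by auto
    have "krammer [] j (Suc j) = krammer ls j (Suc j)"
      using Nil j by (intro same_jones_imp_krammer_eq[of n]) auto
    then show False using krammer_last_zero[OF j(2,1)] krammer_Nil[of j "Suc j"] j ls by auto
  qed
  then show ?case by (simp add: braid_eq.refl)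
next
  case (snoc k ks)
  then have k: "k \<in> {1..<n}" and ks: "set ks \<subseteq> {1..<n}" by auto
  have "krammer ls k (Suc k) = krammer (ks @ [k]) k (Suc k)"
    using same_jones_imp_krammer_eq[OF same_jones_sym[OF snoc.prems(1)]] snoc.prems k by auto
  then obtain js where js: "set js \<subseteq> {1..<n}" "braid_eq n (positive ls) (positive (js @ [k]))"
    using krammer_zero_divisible[OF snoc.prems(3) k] krammer_last_zero[OF ks k] by auto
  have "same_jones n (ks @ [k]) (js @ [k])"
    using snoc.prems(1) braid_eq_imp_same_jones[OF js(2)] by (rule same_jones_trans)
  then have "same_jones n ks js"
    using ks js(1) k by (rule same_jones_cancel)
  then have "braid_eq n (positive ks) (positive js)"
    using ks js(1) by (rule snoc.IH)
  then have "braid_eq n (positive (ks @ [k])) (positive (js @ [k]))"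
    unfolding positive_simps using k by (intro braid_eq.append braid_eq.refl) auto
  then show ?case using js(2) by (blast intro: braid_eq.trans braid_eq.sym)
qed

theorem theorem5p1:
  fixes n :: nat and h :: "braid_word set"
  assumes "n \<ge> 2"
    and "h \<in> carrier (braid_group n)"
    and "h \<noteq> \<one>\<^bsub>braid_group n\<^esub>"
  shows "\<exists>c :: nat \<Rightarrow> nat. (\<forall>i\<in>{1..n}. c i > 0) \<and>
    jones (\<Sum>i=1..n. c i) (cable n c h) \<noteq> \<one>\<^bsub>TL (\<Sum>i=1..n. c i)\<^esub>"
proof (rule ccontr)
  assume contra: "\<not> ?thesis"
  obtain w where w: "w \<in> braid_words n" "h = braid_class n w"
    using assms(2) by (auto simp: braid_group_def)
  have trivial: "jones_word (n * m) (cable_word (\<lambda>_. m) w) = \<one>\<^bsub>TL (n * m)\<^esub>" if "m \<ge> 2" for m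
  proof -
    have "jones (\<Sum>i=1..n. m) (cable n (\<lambda>_. m) h) = \<one>\<^bsub>TL (\<Sum>i=1..n. m)\<^esub>"
      using contra that by (auto dest!: spec[of _ "\<lambda>_. m"])
    moreover have "cable_word (\<lambda>_. m) w \<in> braid_words (n * m)"
      by (rule uniform_cable_words[OF w(1)])
    ultimately show ?thesis
      using cable_braid_class(1)[OF w(1), of "\<lambda>_. m"] by (simp add: w(2) jones_braid_class)
  qed
  obtain k ks where ks: "set ks \<subseteq> {1..<n}" "braid_eq n (wpow k (full_twist n) @ w) (positive ks)"
    using positive_up_to_full_twists[OF w(1)] by blast
  obtain ls where ls: "set ls \<subseteq> {1..<n}" "wpow k (full_twist n) = positive ls"
    using full_twist_power_positive by blast
  have "same_jones n ls ks"
    unfolding same_jones_def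
  proof (intro allI impI)
    fix m :: nat assume m: "2 \<le> m"
    let ?J = "\<lambda>w. jones_word (n * m) (cable_word (\<lambda>_. m) w)"
    interpret ring "TL (n * m)" by (rule ring_TL)
    have l: "positive ls \<in> braid_words n" using ls by simp
    have "?J (positive ks) = ?J (positive ls @ w)"
      using jones_word_cable_cong[OF ks(2), of m] by (simp add: ls)
    also have "\<dots> = ?J (positive ls) \<otimes>\<^bsub>TL (n * m)\<^esub> ?J w"
      unfolding uniform_cable_append by (intro jones_word_append uniform_cable_words l w)
    also have "\<dots> = ?J (positive ls)"
      using jones_word_carrier[OF uniform_cable_words[OF l]] by (simp add: trivial m)
    finally show "?J (positive ls) = ?J (positive ks)" by simp
  qed
  then have "braid_eq n (positive ls) (positive ks)"
    using ls(1) ks(1) by (rule same_jones_imp_braid_eq)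
  then have eq: "braid_eq n (positive ls @ w) (positive ls)"
    using ks(2) unfolding ls by (blast intro: braid_eq.trans braid_eq.sym)
  have 1: "braid_eq n (winv (positive ls) @ positive ls @ w) (winv (positive ls) @ positive ls)"
    using ls(1) by (intro braid_eq.append[OF _ eq] braid_eq.refl) auto
  have 2: "braid_eq n ((winv (positive ls) @ positive ls) @ w) ([] @ w)"
    using ls(1) w(1) by (intro braid_eq.append winv_left braid_eq.refl) auto
  have 3: "braid_eq n (winv (positive ls) @ positive ls) []"
    using ls(1) by (intro winv_left) auto
  have "braid_eq n [] w"
    using braid_eq.trans[OF braid_eq.sym[OF 3] braid_eq.trans[OF braid_eq.sym[OF 1]]] 2 by simp
  then have "h = \<one>\<^bsub>braid_group n\<^esub>"
    by (simp add: w(2) braid_group_def braid_class_eq_iff[symmetric])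
  with assms(3) show False by simp
qed

end
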